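(* Let $n\geq 3$ and let $q=p^h$ with $p$ prime, $h\geq 2$ and $q>27$. Let $c\in\mathcal{C}_{n-1}(n,q)$ and suppose that \begin{itemize} \item $\mathrm{wt}(c)\leq \left(\left\lfloor\frac{1}{2^{n-2}}\sqrt{q}\right\rfloor-1\right)\theta_{n-1}$, when $h>2$, or \item $\mathrm{wt}(c)\leq \left(\left\lfloor\frac{p}{2^n}\right\rfloor-1\right)\theta_{n-1}$, when $h=2$. \end{itemize} Then $c$ is a linear combination of exactly $\left\lceil\frac{\mathrm{wt}(c)}{\theta_{n-1}}\right\rceil$ different hyperplanes of $\mathrm{PG}(n,q)$.
   Context: $\mathrm{PG}(n,q)$ is the Desarguesian projective space of dimension $n$ over $\mathbb{F}_q$. For integers $m\geq -1$, $\theta_m:=\frac{q^{m+1}-1}{q-1}$ (the number of points of an $m$-space). $\mathcal{C}_{n-1}(n,q)$ is the $p$-ary linear code consisting of the $\mathbb{F}_p$-linear span of the characteristic functions (with values in $\mathbb{F}_p$) of the hyperplanes of $\mathrm{PG}(n,q)$, viewed as functions from the point set of $\mathrm{PG}(n,q)$ to $\mathbb{F}_p$. A "linear combination of hyperplanes" means an $\mathbb{F}_p$-linear combination of their characteristic functions. The support $\mathrm{supp}(c)$ of $c$ is the set of points $P$ with $c(P)\neq 0$, and $\mathrm{wt}(c):=|\mathrm{supp}(c)|$. *)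

theory Defs
  imports "HOL-Analysis.Cartesian_Space" "HOL-Library.Function_Algebras"
    "HOL-Computational_Algebra.Primes"
begin

text \<open>
  The projective space \<open>PG(n,q)\<close> is modelled on the vector space \<open>'f ^ 'm\<close>, where \<open>'f\<close> is a
  finite field with \<open>q\<close> elements and \<open>'m\<close> is an index type with \<open>n + 1\<close> elements. Projective
  subspaces are represented by linear subspaces of one dimension more, so that
  incidence is inclusion.
\<close>

definition pg_points :: "('f::{field,finite} ^ 'm::finite) set set" where
  "pg_points = {P. vec.subspace P \<and> vec.dim P = 1}"

definition pg_hyperplanes :: "('f::{field,finite} ^ 'm::finite) set set" where
  "pg_hyperplanes = {H. vec.subspace H \<and> vec.dim H + 1 = CARD('m)}"

text \<open>
  The field \<open>\<bbbF>\<^sub>p\<close> of values is a separate type \<open>'k\<close>. A function from the point set to \<open>'k\<close> is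
  represented by a function on all sets of vectors which vanishes outside the point set.
\<close>

definition char_fun :: "('f::{field,finite} ^ 'm::finite) set \<Rightarrow> ('f ^ 'm) set \<Rightarrow> 'k::field" where
  "char_fun H = (\<lambda>P. if P \<in> pg_points \<and> P \<subseteq> H then 1 else 0)"

definition fun_scale :: "'k::field \<Rightarrow> ('a \<Rightarrow> 'k) \<Rightarrow> 'a \<Rightarrow> 'k" where
  "fun_scale a f = (\<lambda>x. a * f x)"

global_interpretation funspace: vector_space "fun_scale :: 'k::field \<Rightarrow> ('a \<Rightarrow> 'k) \<Rightarrow> 'a \<Rightarrow> 'k"
  by unfold_locales (auto simp: fun_scale_def fun_eq_iff algebra_simps)

definition hyperplane_code :: "(('f::{field,finite} ^ 'm::finite) set \<Rightarrow> 'k::field) set" where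
  "hyperplane_code = funspace.span (char_fun ` pg_hyperplanes)"

definition supp :: "(('f::{field,finite} ^ 'm::finite) set \<Rightarrow> 'k::field) \<Rightarrow> ('f ^ 'm) set set" where
  "supp c = {P \<in> pg_points. c P \<noteq> 0}"

definition wt :: "(('f::{field,finite} ^ 'm::finite) set \<Rightarrow> 'k::field) \<Rightarrow> nat" where
  "wt c = card (supp c)"

text \<open>Intended for \<open>m \<ge> -1\<close>, whence the integer exponent.\<close>

definition theta :: "nat \<Rightarrow> int \<Rightarrow> real" where
  "theta q m = (real q powi (m + 1) - 1) / (real q - 1)"

end

theory Submission
  imports Defs "Jordan_Normal_Form.Determinant"
begin

text \<open>
  The key inequality concerns a codeword in a plane: if the points of a line \<open>\<ell>\<close> take a value
  \<open>\<alpha>\<close> with \<open>s\<close> exceptions, then the support has at least \<open>s(q - s)\<close> points off \<open>\<ell>\<close>. In affine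
  coordinates \<open>(x, y)\<close> the codeword is a polynomial function of degree at most \<open>q - 1\<close>, so its
  \<open>k\<close>-th moment in \<open>x\<close> is a polynomial in \<open>y\<close> of degree at most \<open>k\<close>. The \<open>s \<times> s\<close> Hankel determinant
  of these moments has degree at most \<open>s(s - 1)\<close> and vanishes at each \<open>y\<close> to order at least the
  deficit of the support size on the line \<open>y\<close>.

  Averaging over the planes through a line, a codeword of small weight takes on each line one value
  with few exceptions (this uses \<open>p \<le> \<surd>q\<close>), and averaging over the lines it does so on each subspace.
  In a nonzero codeword some hyperplane is dominated by a nonzero value \<open>\<alpha>\<close>: in a plane this follows
  from the inequality for a longest line through a point of the support, in higher dimension by
  induction, because otherwise the restriction to every hyperplane is a combination of few subspaces
  of codimension two, and these cannot fit together. Subtracting \<open>\<alpha>\<close> times that hyperplane lowers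
  the weight by at least half the size of a hyperplane, so the descent ends after fewer than \<open>\<surd>q\<close>
  hyperplanes. The overlaps of so few hyperplanes are so small that the weight determines their number.

  Everything is counted in nonzero vectors rather than in points.
\<close>

section \<open>Hankel determinants of moments\<close>

lemma field_power_card_minus_1:
  fixes x :: "'f::{field,finite}"
  assumes "x \<noteq> 0"
  shows "x ^ (CARD('f) - 1) = 1"
proof -
  have "bij_betw ((*) x) (UNIV - {0}) (UNIV - {0})"
    by (rule bij_betwI[of _ _ _ "\<lambda>y. y / x"]) (use assms in auto)
  then have "(\<Prod>y\<in>UNIV - {0}. y) = (\<Prod>y\<in>UNIV - {0}. x * y)"
    by (rule prod.reindex_bij_betw[symmetric])
  also have "\<dots> = x ^ (CARD('f) - 1) * (\<Prod>y\<in>UNIV - {0}. y)"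
    by (simp add: prod.distrib card_Diff_singleton)
  finally show ?thesis by simp
qed

text \<open>Replacing \<open>x\<close> by \<open>a * x\<close> multiplies the sum by
  \<open>a ^ k\<close>, and some nonzero \<open>a\<close> has \<open>a ^ k \<noteq> 1\<close> since
  \<open>X ^ k - 1\<close> has at most \<open>k\<close> roots. For \<open>k = 0\<close> the shift by
  1 shows that \<open>q\<close> copies of 1 add up to 0.\<close>

lemma sum_field_power_eq_0:
  assumes "k < CARD('f::{field,finite}) - 1"
  shows "(\<Sum>x\<in>UNIV. (x::'f) ^ k) = 0"
proof (cases "k = 0")
  case True
  have "bij (\<lambda>x::'f. x + 1)"
    by (rule bij_betwI[of _ _ _ "\<lambda>y. y - 1"]) auto
  then have "(\<Sum>x\<in>UNIV. (x::'f)) = (\<Sum>x\<in>UNIV. x + 1)"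
    by (rule sum.reindex_bij_betw[symmetric])
  then show ?thesis
    using True by (simp add: sum.distrib)
next
  case False
  define r where "r = monom (1::'f) k - 1"
  have deg: "degree r \<le> k"
    unfolding r_def by (rule degree_diff_le) (auto simp: degree_monom_le)
  have "coeff r k = 1"
    using False by (simp add: r_def)
  then have "r \<noteq> 0" by auto
  have "\<exists>a::'f. a \<noteq> 0 \<and> a ^ k \<noteq> 1"
  proof (rule ccontr)
    assume "\<not> ?thesis"
    then have "UNIV - {0} \<subseteq> {x. poly r x = 0}"
      by (auto simp: r_def poly_monom)
    then have "card (UNIV - {0::'f}) \<le> card {x. poly r x = 0}"
      by (intro card_mono) auto
    also have "\<dots> \<le> degree r"
      by (rule card_poly_roots_bound) fact
    finally show False
      using deg assms by (simp add: card_Diff_singleton)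
  qed
  then obtain a :: 'f where a: "a \<noteq> 0" "a ^ k \<noteq> 1" by blast
  have "bij ((*) a)"
    by (rule bij_betwI[of _ _ _ "\<lambda>y. y / a"]) (use a in auto)
  then have "(\<Sum>x\<in>UNIV. (x::'f) ^ k) = (\<Sum>x\<in>UNIV. (a * x) ^ k)"
    by (rule sum.reindex_bij_betw[symmetric])
  also have "\<dots> = a ^ k * (\<Sum>x\<in>UNIV. x ^ k)"
    by (simp add: power_mult_distrib sum_distrib_left)
  finally have "(a ^ k - 1) * (\<Sum>x\<in>UNIV. x ^ k) = 0"
    by (simp add: algebra_simps)
  with a show ?thesis by simp
qed

lemma poly_eq_sum_lessThan:
  fixes g :: "'a::comm_semiring_1 poly"
  assumes "degree g < n"
  shows "poly g x = (\<Sum>l<n. coeff g l * x ^ l)"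
proof -
  have "(\<Sum>l<n. coeff g l * x ^ l) = (\<Sum>l\<le>degree g. coeff g l * x ^ l)"
    using assms by (intro sum.mono_neutral_right) (auto simp: coeff_eq_0)
  then show ?thesis by (simp add: poly_altdef)
qed

lemma prod_linear_factors:
  fixes Z :: "'a::field set"
  assumes "finite Z"
  shows "degree (\<Prod>z\<in>Z. [:-z, 1:]) = card Z" "lead_coeff (\<Prod>z\<in>Z. [:-z, 1:]) = 1"
    and "poly (\<Prod>z\<in>Z. [:-z, 1:]) x = 0 \<longleftrightarrow> x \<in> Z"
proof -
  show "degree (\<Prod>z\<in>Z. [:-z, 1:]) = card Z"
    by (subst degree_prod_eq_sum_degree) auto
  show "lead_coeff (\<Prod>z\<in>Z. [:-z, 1:]) = 1"
    by (simp add: lead_coeff_prod)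
  show "poly (\<Prod>z\<in>Z. [:-z, 1:]) x = 0 \<longleftrightarrow> x \<in> Z"
    using assms by (auto simp: poly_prod)
qed

text \<open>Combining the rows of the moment matrix with the coefficients of \<open>g\<close> gives
  the moments of \<open>F\<close> times \<open>g\<close>. This turns statements about the matrix
  into statements about the values of \<open>g\<close> on the support of \<open>F\<close>.\<close>

lemma moment_sum_zero:
  fixes F :: "'f::{field,finite} \<Rightarrow> 'f"
  assumes "degree g < n"
  shows "(\<Sum>l<n. coeff g l * (\<Sum>x\<in>UNIV. F x * x ^ (l + j))) = (\<Sum>x\<in>UNIV. F x * poly g x * x ^ j)"
  unfolding poly_eq_sum_lessThan[OF assms] sum_distrib_left sum_distrib_right
  by (subst sum.swap) (simp add: power_add mult_ac)

text \<open>In each Leibniz term the degrees add up to at most the sum of all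
  \<open>i + p i\<close>, and the permutation \<open>p\<close> leaves the sum of the indices
  unchanged.\<close>

lemma hankel_det_degree:
  fixes h :: "nat \<Rightarrow> 'f::field poly"
  assumes "\<And>k. degree (h k) \<le> k"
  shows "degree (det (mat n n (\<lambda>(i, j). h (i + j)))) \<le> n * (n - 1)"
proof -
  let ?M = "mat n n (\<lambda>(i, j). h (i + j))"
  have "degree (signof p * (\<Prod>i = 0..<n. ?M $$ (i, p i))) \<le> n * (n - 1)"
    if p: "p permutes {0..<n}" for p
  proof -
    have "degree (signof p * (\<Prod>i = 0..<n. ?M $$ (i, p i))) \<le> degree (\<Prod>i = 0..<n. ?M $$ (i, p i))"
      by (auto simp: sign_def)
    also have "\<dots> \<le> (\<Sum>i = 0..<n. degree (?M $$ (i, p i)))"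
      by (rule order.trans[OF degree_prod_sum_le]) (auto simp: o_def)
    also have "\<dots> \<le> (\<Sum>i = 0..<n. i + p i)"
      using p permutes_in_image[OF p] by (intro sum_mono) (auto intro: assms)
    also have "\<dots> = (\<Sum>i = 0..<n. i) + (\<Sum>i = 0..<n. p i)"
      by (simp add: sum.distrib)
    also have "(\<Sum>i = 0..<n. p i) = (\<Sum>i = 0..<n. i)"
      using sum.permute[OF p, of "\<lambda>i. i"] by (simp add: o_def)
    also have "(\<Sum>i = 0..<n. i) + (\<Sum>i = 0..<n. i) = n * (n - 1)"
      by (induction n) (auto simp: algebra_simps)
    finally show ?thesis .
  qed
  then show ?thesis
    by (subst det_def'[of _ n]) (auto intro!: degree_sum_le simp: finite_permutations)
qed

text \<open>
  If \<open>F\<close> has \<open>t\<close> nonzero values, located at the roots of \<open>g\<close>, then the unitriangular change of basis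
  from \<open>1, X, \<dots>\<close> to \<open>1, \<dots>, X\<^sup>t\<^sup>-\<^sup>1, g, Xg, \<dots>\<close> makes the last \<open>n - t\<close> rows vanish at \<open>y\<close>.
\<close>

lemma hankel_det_dvd:
  fixes F :: "'f::{field,finite} \<Rightarrow> 'f" and h :: "nat \<Rightarrow> 'f poly"
  assumes h: "\<And>k. poly (h k) y = (\<Sum>x\<in>UNIV. F x * x ^ k)"
  shows "[:-y, 1:] ^ (n - card {x. F x \<noteq> 0}) dvd det (mat n n (\<lambda>(i, j). h (i + j)))"
proof -
  let ?M = "mat n n (\<lambda>(i, j). h (i + j))"
  define Z where "Z = {x. F x \<noteq> 0}"
  define t where "t = card Z"
  define g where "g = (\<lambda>i. (\<Prod>z\<in>Z. [:-z, 1:]) * monom 1 (i - t))"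
  have nz: "(\<Prod>z\<in>Z. [:-z, 1:]) \<noteq> 0"
    by (auto simp: Z_def)
  have deg: "degree (g i) = i" and lc: "coeff (g i) i = 1" if "t \<le> i" for i
  proof -
    show d: "degree (g i) = i"
      using that nz by (simp add: g_def degree_mult_eq degree_monom_eq prod_linear_factors t_def)
    have "lead_coeff (g i) = 1"
      using prod_linear_factors(2)[of Z] by (simp add: g_def lead_coeff_mult degree_monom_eq)
    then show "coeff (g i) i = 1" using d by simp
  qed
  define P where "P = mat n n (\<lambda>(i, j). if i < t then (if i = j then 1 else 0) else [:coeff (g i) j:])"
  have P: "P \<in> carrier_mat n n" and M: "?M \<in> carrier_mat n n"
    by (auto simp: P_def)
  have "det P = prod_list (diag_mat P)"
    by (rule det_lower_triangular[OF _ P]) (auto simp: P_def coeff_eq_0 deg)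
  also have "\<dots> = 1"
    unfolding prod_list_diag_prod by (rule prod.neutral) (auto simp: P_def lc one_pCons)
  finally have "det ?M = det (P * ?M)"
    by (simp add: det_mult[OF P M])
  moreover have "[:-y, 1:] dvd (P * ?M) $$ (i, j)" if i: "t \<le> i" "i < n" and j: "j < n" for i j
  proof -
    have "poly ((P * ?M) $$ (i, j)) y = (\<Sum>l<n. coeff (g i) l * (\<Sum>x\<in>UNIV. F x * x ^ (l + j)))"
      using i j by (auto simp: P_def scalar_prod_def poly_sum h atLeast0LessThan)
    also have "\<dots> = (\<Sum>x\<in>UNIV. F x * poly (g i) x * x ^ j)"
      using i by (intro moment_sum_zero) (simp add: deg)
    also have "\<dots> = 0"
    proof (rule sum.neutral, safe)
      fix x
      show "F x * poly (g i) x * x ^ j = 0"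
        by (cases "x \<in> Z") (auto simp: g_def prod_linear_factors, auto simp: Z_def)
    qed
    finally show ?thesis by (simp add: poly_eq_0_iff_dvd)
  qed
  \<comment> \<open>Each Leibniz term has one factor from each of the rows \<open>t\<close> to
    \<open>n - 1\<close>.\<close>
  moreover have "[:-y, 1:] ^ (n - t) dvd det A"
    if A: "A \<in> carrier_mat n n" and dvd: "\<And>i j. t \<le> i \<Longrightarrow> i < n \<Longrightarrow> j < n \<Longrightarrow> [:-y, 1:] dvd A $$ (i, j)" for A
  proof -
    have "[:-y, 1:] ^ (n - t) dvd (\<Prod>i = 0..<n. A $$ (i, p i))" if p: "p permutes {0..<n}" for p
    proof -
      have "[:-y, 1:] ^ (n - t) = (\<Prod>i = t..<n. [:-y, 1:])" by simp
      also have "\<dots> dvd (\<Prod>i = t..<n. A $$ (i, p i))"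
        using permutes_in_image[OF p] by (intro prod_dvd_prod dvd) auto
      also have "\<dots> dvd (\<Prod>i = 0..<n. A $$ (i, p i))"
        by (intro prod_dvd_prod_subset) auto
      finally show ?thesis .
    qed
    then show ?thesis
      by (subst det_def'[OF A]) (auto intro!: dvd_sum)
  qed
  ultimately show ?thesis
    using P M by (simp add: t_def Z_def)
qed

text \<open>The value of the determinant at \<open>y\<close> is already nonzero. Otherwise a kernel
  vector, read as a polynomial \<open>g\<close> of degree below \<open>n\<close>, makes
  \<open>F\<close> times \<open>g\<close> orthogonal to all powers below \<open>n\<close>. Testing
  against the polynomial with roots at all support points but \<open>z\<close> gives
  \<open>g(z) = 0\<close>, so \<open>g\<close> has \<open>n\<close> roots.\<close>

lemma hankel_det_nonzero:
  fixes F :: "'f::{field,finite} \<Rightarrow> 'f" and h :: "nat \<Rightarrow> 'f poly"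
  assumes h: "\<And>k. poly (h k) y = (\<Sum>x\<in>UNIV. F x * x ^ k)"
    and n: "n = card {x. F x \<noteq> 0}"
  shows "det (mat n n (\<lambda>(i, j). h (i + j))) \<noteq> 0"
proof
  let ?M = "mat n n (\<lambda>(i, j). h (i + j))"
  define A where "A = mat n n (\<lambda>(i, j). poly (h (i + j)) y)"
  have A: "A \<in> carrier_mat n n" by (simp add: A_def)
  have "poly (det ?M) y = det A"
  proof -
    have "poly (signof p) y = signof p" for p :: "nat \<Rightarrow> nat"
      by (simp add: sign_def)
    moreover have "(\<Prod>i = 0..<n. poly (?M $$ (i, p i)) y) = (\<Prod>i = 0..<n. A $$ (i, p i))"
      if "p permutes {0..<n}" for p
      using permutes_in_image[OF that] by (intro prod.cong) (auto simp: A_def)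
    ultimately show ?thesis
      by (simp add: det_def'[of _ n] A poly_sum poly_prod)
  qed
  moreover assume "det ?M = 0"
  ultimately have "det A = 0" by simp
  then obtain v where v: "v \<in> carrier_vec n" "v \<noteq> 0\<^sub>v n" "A *\<^sub>v v = 0\<^sub>v n"
    using det_0_iff_vec_prod_zero_field[OF A] by auto
  define g where "g = (\<Sum>i<n. monom (vec_index v i) i)"
  have coeff_g: "coeff g i = (if i < n then vec_index v i else 0)" for i
    by (auto simp: g_def coeff_sum)
  have "g \<noteq> 0"
  proof
    assume "g = 0"
    then have "vec_index v i = 0" if "i < n" for i
      using coeff_g[of i] that by simp
    then show False using v by (auto simp: vec_eq_iff)
  qed
  have "n > 0" using v by (auto intro!: eq_vecI Nat.gr0I)
  have deg_g: "degree g < n"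
    using \<open>n > 0\<close> coeff_g by (intro degree_lessI) auto
  have orth: "(\<Sum>x\<in>UNIV. F x * poly g x * x ^ j) = 0" if "j < n" for j
  proof -
    have "(\<Sum>x\<in>UNIV. F x * poly g x * x ^ j) = (\<Sum>l<n. coeff g l * poly (h (l + j)) y)"
      by (simp add: moment_sum_zero[OF deg_g] h)
    also have "\<dots> = vec_index (A *\<^sub>v v) j"
      using that v(1) by (auto simp: A_def scalar_prod_def coeff_g atLeast0LessThan add.commute mult.commute
          intro!: sum.cong)
    finally show ?thesis using v that by simp
  qed
  define Z where "Z = {x. F x \<noteq> 0}"
  have "poly g z = 0" if z: "z \<in> Z" for z
  proof -
    define r where "r = (\<Prod>w\<in>Z - {z}. [:-w, 1:])"
    have "degree r < n"
      using z \<open>n > 0\<close> n unfolding r_def Z_def[symmetric]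
      by (subst prod_linear_factors) (auto simp: card_Diff_singleton)
    then have "(\<Sum>x\<in>UNIV. F x * poly g x * poly r x) = (\<Sum>j<n. coeff r j * (\<Sum>x\<in>UNIV. F x * poly g x * x ^ j))"
      using moment_sum_zero[of r n "\<lambda>x. F x * poly g x" 0] by simp
    also have "\<dots> = 0" using orth by simp
    finally have "0 = (\<Sum>x\<in>UNIV. F x * poly g x * poly r x)" by simp
    also have "\<dots> = (\<Sum>x\<in>{z}. F x * poly g x * poly r x)"
      by (rule sum.mono_neutral_right) (auto simp: r_def prod_linear_factors Z_def)
    finally have "F z * poly g z * poly r z = 0" by simp
    moreover have "poly r z \<noteq> 0" by (simp add: r_def prod_linear_factors)
    ultimately show ?thesis using z by (simp add: Z_def)
  qed
  then have "card Z \<le> card {x. poly g x = 0}"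
    by (intro card_mono) auto
  also have "\<dots> \<le> degree g" by (rule card_poly_roots_bound) fact
  finally show False using deg_g n by (simp add: Z_def)
qed

text \<open>\<open>n\<close> is the support size on the line \<open>y\<^sub>0\<close>, which makes
  the determinant nonzero. The deficit of each line is at most the order of \<open>y\<close> as a
  root, and the orders add up to at most the degree. Truncated subtraction discards lines with
  \<open>n\<close> or more support points.\<close>

lemma hankel_bound:
  fixes F :: "'f::{field,finite} \<Rightarrow> 'f \<Rightarrow> 'f" and h :: "nat \<Rightarrow> 'f poly"
  assumes h: "\<And>k y. poly (h k) y = (\<Sum>x\<in>UNIV. F x y * x ^ k)"
    and deg: "\<And>k. degree (h k) \<le> k"
    and n: "n = card {x. F x y\<^sub>0 \<noteq> 0}"
  shows "(\<Sum>y\<in>UNIV. n - card {x. F x y \<noteq> 0}) \<le> n * (n - 1)"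
proof -
  define D where "D = det (mat n n (\<lambda>(i, j). h (i + j)))"
  have D: "D \<noteq> 0"
    unfolding D_def by (rule hankel_det_nonzero[OF h n])
  have ord: "n - card {x. F x y \<noteq> 0} \<le> order y D" for y
  proof -
    have "[:-y, 1:] ^ (n - card {x. F x y \<noteq> 0}) dvd D"
      unfolding D_def by (rule hankel_det_dvd) (rule h)
    then show ?thesis using D by (simp add: order_divides)
  qed
  have "(\<Sum>y\<in>UNIV. n - card {x. F x y \<noteq> 0}) \<le> (\<Sum>y\<in>UNIV. order y D)"
    by (intro sum_mono ord)
  also have "\<dots> = (\<Sum>y | poly D y = 0. order y D)"
    using D by (intro sum.mono_neutral_right) (auto simp: order_root)
  also have "\<dots> \<le> degree D"
    by (rule sum_order_le_degree[OF D])
  also have "\<dots> \<le> n * (n - 1)"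
    unfolding D_def by (rule hankel_det_degree[OF deg])
  finally show ?thesis .
qed

section \<open>Subspaces of a finite vector space\<close>

text \<open>Functionals are encoded by vectors, so that they too form a finite set that can be
  summed over and counted.\<close>

definition dotp :: "'f::field ^ 'm::finite \<Rightarrow> 'f ^ 'm \<Rightarrow> 'f" where
  "dotp u v = (\<Sum>i\<in>UNIV. vec_nth u i * vec_nth v i)"

lemma dotp_add_right: "dotp u (v + w) = dotp u v + dotp u w"
  and dotp_diff_right: "dotp u (v - w) = dotp u v - dotp u w"
  and dotp_scale_right: "dotp u (c *s v) = c * dotp u v"
  and dotp_zero_right: "dotp u 0 = 0"
  and dotp_zero_left: "dotp 0 u = 0"
  and dotp_commute: "dotp u v = dotp v u"
  by (simp_all add: dotp_def algebra_simps sum.distrib sum_subtractf sum_distrib_left)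

lemmas dotp_simps = dotp_add_right dotp_diff_right dotp_scale_right dotp_zero_right dotp_zero_left

lemma subspace_kernel: "vec.subspace V \<Longrightarrow> vec.subspace {v\<in>V. dotp u v = 0}"
  by (auto simp: vec.subspace_def dotp_simps)

lemma dotp_nonzero_exists:
  assumes "u \<noteq> 0"
  shows "\<exists>v. dotp u v \<noteq> 0"
proof -
  obtain i where i: "vec_nth u i \<noteq> 0"
    using assms by (auto simp: Finite_Cartesian_Product.vec_eq_iff)
  have "dotp u (axis i 1) = vec_nth u i"
    by (simp add: dotp_def axis_def if_distrib sum.delta cong: if_cong)
  with i show ?thesis by metis
qed

lemma separating_functional:
  fixes W :: "('f::field ^ 'm::finite) set"
  assumes W: "vec.subspace W" and C: "C \<notin> W"
  shows "\<exists>u. (\<forall>w\<in>W. dotp u w = 0) \<and> dotp u C = 1"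
proof -
  obtain B where B: "B \<subseteq> W" "vec.independent B" "W \<subseteq> vec.span B"
    using vec.basis_exists[of W] by metis
  have span: "vec.span B = W"
    by (rule vec.span_subspace) (use B W in auto)
  then have "vec.independent (insert C B)"
    using B(2) C by (intro vec.independent_insertI) auto
  \<comment> \<open>The extension theorem supplies a linear map that sends \<open>C\<close> to a
    unit vector and \<open>B\<close> to 0. The coordinate \<open>undefined\<close> is an arbitrary
    one, and that row of the matrix is the functional.\<close>
  then obtain g where g: "Vector_Spaces.linear (*s) (*s) g"
    and gB: "\<forall>x\<in>insert C B. g x = (if x = C then axis undefined 1 else (0 :: 'f ^ 'm))"
    using vec.linear_independent_extend[of "insert C B" "\<lambda>x. if x = C then axis undefined 1 else 0"] by auto
  define u where "u = vec_nth (matrix g) undefined"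
  have dot: "dotp u v = vec_nth (g v) undefined" for v
  proof -
    have "vec_nth (matrix g *v v) undefined = dotp u v"
      by (simp add: u_def dotp_def matrix_vector_mult_def)
    then show ?thesis by (simp only: matrix_works[OF g])
  qed
  have "g w = 0" if "w \<in> W" for w
  proof -
    have "w \<in> vec.span B" using that span by simp
    moreover have "g x = 0" if "x \<in> B" for x
      using gB that B(1) C by auto
    ultimately show ?thesis
      by (metis vec.linear_eq_0_on_span[OF g])
  qed
  then have "\<forall>w\<in>W. dotp u w = 0" by (simp add: dot)
  moreover have "dotp u C = 1" using gB by (simp add: dot)
  ultimately show ?thesis by blast
qed

section \<open>Extending a subspace by one vector: cardinalities and double counting\<close>

lemma span_insert_subspace:
  assumes "vec.subspace K"
  shows "vec.span (insert w K) = {k + c *s w | k c. k \<in> K}"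
proof -
  have K: "vec.span K = K" using assms by (simp add: vec.span_eq_iff)
  have "\<exists>k' c. x = k' + c *s w \<and> k' \<in> K" if "x - k *s w \<in> K" for x k
    using that by (intro exI[of _ "x - k *s w"] exI[of _ k]) simp
  moreover have "\<exists>d. k + c *s w - d *s w \<in> K" if "k \<in> K" for k c
    using that by (intro exI[of _ c]) simp
  ultimately show ?thesis
    unfolding vec.span_insert K by blast
qed

lemma in_span_insert_sym:
  assumes K: "vec.subspace K" and v: "v \<in> vec.span (insert w K)" "v \<notin> K"
  shows "w \<in> vec.span (insert v K)"
proof -
  have "vec.span K = K" using K by (simp add: vec.span_eq_iff)
  with v have "v \<notin> vec.span K" by metis
  then show ?thesis using vec.in_span_insert v(1) by blast
qed

lemma card_span_insert:
  fixes K :: "('f::{field,finite} ^ 'm::finite) set"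
  assumes K: "vec.subspace K" and w: "w \<notin> K"
  shows "card (vec.span (insert w K)) = CARD('f) * card K"
proof -
  have "inj_on (\<lambda>(c, k). k + c *s w) (UNIV \<times> K)"
  proof (rule inj_onI, clarify)
    fix c d k l assume kl: "k \<in> K" "l \<in> K" and eq: "k + c *s w = l + d *s w"
    have "(c - d) *s w = l - k"
      using eq by (simp add: algebra_simps vec.scale_left_diff_distrib)
    then have *: "(c - d) *s w \<in> K"
      using kl K by (simp add: vec.subspace_diff)
    have "c = d"
    proof (rule ccontr)
      assume "c \<noteq> d"
      then have "w = inverse (c - d) *s ((c - d) *s w)" by simp
      then have "w \<in> K" using * K vec.subspace_scale by metis
      then show False using w by simp
    qed
    then show "c = d \<and> k = l" using eq by simp
  qed
  then have "card ((\<lambda>(c, k). k + c *s w) ` (UNIV \<times> K)) = CARD('f) * card K"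
    by (simp add: card_image card_cartesian_product)
  moreover have "(\<lambda>(c, k). k + c *s w) ` (UNIV \<times> K) = vec.span (insert w K)"
    unfolding span_insert_subspace[OF K] by auto
  ultimately show ?thesis by simp
qed

lemma card_subspace:
  fixes V :: "('f::{field,finite} ^ 'm::finite) set"
  assumes V: "vec.subspace V"
  shows "card V = CARD('f) ^ vec.dim V"
proof -
  obtain B where B: "B \<subseteq> V" "vec.independent B" "V \<subseteq> vec.span B" "card B = vec.dim V"
    using vec.basis_exists[of V] by metis
  have "card (vec.span B) = CARD('f) ^ card B"
    using finite[of B] B(2)
  proof (induction B rule: finite_induct)
    case (insert x B)
    then have "vec.independent B" "x \<notin> vec.span B"
      by (auto simp: vec.independent_insert)
    moreover have "vec.span (insert x B) = vec.span (insert x (vec.span B))"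
      by (simp add: vec.span_insert vec.span_span)
    ultimately show ?case
      using insert by (simp add: card_span_insert vec.subspace_span)
  qed simp
  moreover have "vec.span B = V"
    using B V by (metis vec.span_subspace)
  ultimately show ?thesis using B by simp
qed

lemma card_field_gt_1: "1 < CARD('f::{field,finite})"
proof -
  have "card {0, 1::'f} \<le> CARD('f)" by (rule card_mono) auto
  then show ?thesis by simp
qed

lemma card_kernel:
  fixes V :: "('f::{field,finite} ^ 'm::finite) set"
  assumes V: "vec.subspace V" and v: "v \<in> V" "dotp u v \<noteq> 0"
  shows "CARD('f) * card {v\<in>V. dotp u v = 0} = card V"
proof -
  let ?K = "{v\<in>V. dotp u v = 0}"
  note K = subspace_kernel[OF V, of u]
  have "vec.span (insert v ?K) = V"
  proof
    show "vec.span (insert v ?K) \<subseteq> V"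
      using V v by (intro vec.span_minimal) auto
    show "V \<subseteq> vec.span (insert v ?K)"
    proof
      fix x assume x: "x \<in> V"
      let ?c = "dotp u x / dotp u v"
      have "x - ?c *s v \<in> ?K"
        using x v V by (auto simp: dotp_simps vec.subspace_diff vec.subspace_scale)
      then show "x \<in> vec.span (insert v ?K)"
        unfolding span_insert_subspace[OF K]
        by (intro CollectI exI[of _ "x - ?c *s v"] exI[of _ ?c]) simp
    qed
  qed
  then show ?thesis using card_span_insert[OF K, of v] v by simp
qed

text \<open>A functional that vanishes on \<open>G\<close> but not on all of \<open>V\<close> has a
  kernel in \<open>V\<close> of the same size as \<open>G\<close>. Codimension one is expressed by a
  ratio of cardinalities because everything is counted.\<close>

lemma hyperplane_functional:
  fixes V :: "('f::{field,finite} ^ 'm::finite) set"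
  assumes V: "vec.subspace V" and G: "vec.subspace G" "G \<subseteq> V" "CARD('f) * card G = card V"
  obtains u v where "G = {v\<in>V. dotp u v = 0}" "v \<in> V" "dotp u v \<noteq> 0"
proof -
  have "card G > 0" using G(1) by (auto simp: card_gt_0_iff dest: vec.subspace_0)
  then have "G \<noteq> V"
    using G(3) card_field_gt_1[where 'f='f] by auto
  then obtain C where C: "C \<in> V" "C \<notin> G" using G(2) by auto
  obtain u where u: "\<forall>w\<in>G. dotp u w = 0" "dotp u C = 1"
    using separating_functional[OF G(1) C(2)] by auto
  have "CARD('f) * card {v\<in>V. dotp u v = 0} = card V"
    using card_kernel[OF V C(1)] u by simp
  then have "card G = card {v\<in>V. dotp u v = 0}"
    using G(3)[symmetric] by simp
  moreover have "G \<subseteq> {v\<in>V. dotp u v = 0}"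
    using u(1) G(2) by blast
  ultimately have "G = {v\<in>V. dotp u v = 0}"
    by (intro card_subset_eq finite)
  moreover have "dotp u C \<noteq> 0" using u(2) by simp
  ultimately show thesis by (rule that[OF _ C(1)])
qed

text \<open>By the exchange property, \<open>v\<close> in \<open>L\<close> would put
  \<open>w\<close> into \<open>L\<close>.\<close>

lemma span_insert_avoids:
  assumes K: "vec.subspace K" and L: "vec.subspace L" "K \<subseteq> L"
    and v: "v \<in> vec.span (insert w K)" "v \<notin> K" and w: "w \<notin> L"
  shows "v \<notin> L"
proof
  assume "v \<in> L"
  then have "vec.span (insert v K) \<subseteq> L"
    using L by (intro vec.span_minimal) auto
  then show False
    using in_span_insert_sym[OF K v] w by auto
qed

text \<open>
  Replaces sums over the subspaces of dimension one more than \<open>K\<close> by sums over the vectors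
  \<open>w\<close> that span them together with \<open>K\<close>.
\<close>

lemma sum_card_span_insert:
  fixes V :: "('f::{field,finite} ^ 'm::finite) set"
  assumes K: "vec.subspace K" and L: "vec.subspace L" "K \<subseteq> L" and V: "vec.subspace V" "L \<subseteq> V"
  shows "(\<Sum>w\<in>V - L. card {v \<in> vec.span (insert w K) - K. P v})
    = (CARD('f) - 1) * card K * card {v \<in> V - L. P v}"
proof -
  have "{v \<in> vec.span (insert w K) - K. P v} = {v \<in> {v \<in> V - L. P v}. v \<in> vec.span (insert w K)}"
    if w: "w \<in> V - L" for w
  proof -
    have "vec.span (insert w K) \<subseteq> V"
      using w L V by (intro vec.span_minimal) auto
    then show ?thesis
      using span_insert_avoids[OF K L] w L by blast
  qed
  then have "(\<Sum>w\<in>V - L. card {v \<in> vec.span (insert w K) - K. P v})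
    = (\<Sum>w\<in>V - L. card {v \<in> {v \<in> V - L. P v}. v \<in> vec.span (insert w K)})"
    by (intro sum.cong) auto
  \<comment> \<open>Double counting of pairs \<open>(w, v)\<close>: by exchange, the
    \<open>w\<close> whose span with \<open>K\<close> contains \<open>v\<close> are those in the
    span of \<open>v\<close> and \<open>K\<close>, outside \<open>K\<close>.\<close>
  also have "\<dots> = (\<Sum>v\<in>{v \<in> V - L. P v}. (CARD('f) - 1) * card K)"
  proof (rule sum_multicount_gen, simp, simp, clarify)
    fix v assume v: "v \<in> V" "v \<notin> L"
    have "{w \<in> V - L. v \<in> vec.span (insert w K)} = vec.span (insert v K) - K"
    proof -
      have "vec.span (insert v K) \<subseteq> V"
        using v L V by (intro vec.span_minimal) auto
      then show ?thesis
        using span_insert_avoids[OF K L, of _ v] in_span_insert_sym[OF K] v L(2) by blast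
    qed
    moreover have "K \<subseteq> vec.span (insert v K)"
      by (auto intro: vec.span_base)
    moreover have "v \<notin> K" using v L by auto
    ultimately show "card {w \<in> V - L. v \<in> vec.span (insert w K)} = (CARD('f) - 1) * card K"
      using card_span_insert[OF K, of v]
      by (auto simp: card_Diff_subset algebra_simps)
  qed
  finally show ?thesis by simp
qed

lemma card_span_singleton:
  fixes u :: "'f::{field,finite} ^ 'm::finite"
  assumes "u \<noteq> 0"
  shows "card (vec.span {u}) = CARD('f)"
proof -
  have "vec.span (insert u {0}) = vec.span (insert 0 {u})"
    by (rule arg_cong[of _ _ vec.span]) auto
  then show ?thesis
    using card_span_insert[of "{0}" u] assms by simp
qed

lemma span_pair_eq:
  fixes L :: "('f::{field,finite} ^ 'm::finite) set"
  assumes L: "vec.subspace L" "card L = CARD('f)\<^sup>2" and u: "u \<in> L" "u \<noteq> 0"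
    and v: "v \<in> L" "v \<notin> vec.span {u}"
  shows "vec.span {v, u} = L"
proof -
  have "vec.span {v, u} = vec.span (insert v (vec.span {u}))"
    by (simp add: vec.span_insert[of v] vec.span_span)
  then have "card (vec.span {v, u}) = card L"
    using card_span_insert[of "vec.span {u}" v] v L u
    by (simp add: power2_eq_square card_span_singleton vec.subspace_span)
  moreover have "vec.span {v, u} \<subseteq> L"
    using L u v by (intro vec.span_minimal) auto
  ultimately show ?thesis
    by (intro card_subset_eq) auto
qed

lemma card_independent_pairs:
  fixes L :: "('f::{field,finite} ^ 'm::finite) set"
  assumes "vec.subspace L"
  shows "card (SIGMA u:L - {0}. L - vec.span {u}) = (card L - 1) * (card L - CARD('f))"
proof -
  have "card (L - vec.span {u}) = card L - CARD('f)" if "u \<in> L - {0}" for u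
  proof -
    have "vec.span {u} \<subseteq> L" using that assms by (intro vec.span_minimal) auto
    then show ?thesis using that by (simp add: card_Diff_subset card_span_singleton)
  qed
  then show ?thesis
    using assms by (subst card_SigmaI) (auto simp: card_Diff_singleton vec.subspace_0)
qed

section \<open>The inequality in a plane\<close>

text \<open>The indicator of \<open>z = 0\<close> is \<open>1 - z ^ (q - 1)\<close>. In the binomial
  expansion of \<open>(a * x + z) ^ (q - 1)\<close> the sum over \<open>x\<close> of
  \<open>x ^ (i + k)\<close> vanishes unless \<open>i + k \<ge> q - 1\<close>, so
  \<open>z = b + c * y\<close> survives only in powers \<open>q - 1 - i \<le> k\<close>.\<close>

lemma affine_zero_moments:
  fixes a b c :: "'f::{field,finite}"
  obtains H :: "nat \<Rightarrow> 'f poly"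
  where "\<And>k. degree (H k) \<le> k"
    and "\<And>k y. poly (H k) y = (\<Sum>x\<in>UNIV. (if a * x + b + c * y = 0 then 1 else 0) * x ^ k)"
proof -
  let ?n = "CARD('f) - 1"
  let ?S = "\<lambda>k. \<Sum>x\<in>UNIV. (x::'f) ^ k"
  define H where "H = (\<lambda>k. [:?S k:] -
    (\<Sum>i\<le>?n. smult (of_nat (?n choose i) * a ^ i * ?S (i + k)) ([:b, c:] ^ (?n - i))))"
  have n: "?n > 0" using card_field_gt_1[where 'f='f] by simp
  have "degree (H k) \<le> k" for k
    unfolding H_def
  proof (intro degree_diff_le degree_sum_le)
    fix i assume "i \<in> {..?n}"
    show "degree (smult (of_nat (?n choose i) * a ^ i * ?S (i + k)) ([:b, c:] ^ (?n - i))) \<le> k"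
    proof (cases "i + k < ?n")
      case True
      then show ?thesis by (simp add: sum_field_power_eq_0)
    next
      case False
      have "degree (smult (of_nat (?n choose i) * a ^ i * ?S (i + k)) ([:b, c:] ^ (?n - i)))
        \<le> degree ([:b, c:] ^ (?n - i))"
        by (rule degree_smult_le)
      also have "\<dots> \<le> degree [:b, c:] * (?n - i)"
        by (rule degree_power_le)
      also have "\<dots> \<le> 1 * (?n - i)"
        by (intro mult_right_mono) auto
      finally show ?thesis using False by simp
    qed
  qed auto
  moreover have "poly (H k) y = (\<Sum>x\<in>UNIV. (if a * x + b + c * y = 0 then 1 else 0) * x ^ k)" for k y
  proof -
    have "(if z = 0 then 1 else 0) = 1 - z ^ ?n" for z :: 'f
      using n field_power_card_minus_1[of z] by (auto simp: power_0_left)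
    then have "(\<Sum>x\<in>UNIV. (if a * x + b + c * y = 0 then 1 else 0) * x ^ k)
      = ?S k - (\<Sum>x\<in>UNIV. (a * x + (b + c * y)) ^ ?n * x ^ k)"
      by (simp add: left_diff_distrib sum_subtractf add.assoc)
    also have "(\<Sum>x\<in>UNIV. (a * x + z) ^ ?n * x ^ k)
      = (\<Sum>i\<le>?n. of_nat (?n choose i) * a ^ i * ?S (i + k) * z ^ (?n - i))" for z
    proof -
      have "(\<Sum>x\<in>UNIV. (a * x + z) ^ ?n * x ^ k)
        = (\<Sum>x\<in>UNIV. \<Sum>i\<le>?n. of_nat (?n choose i) * a ^ i * z ^ (?n - i) * x ^ (i + k))"
        by (simp add: binomial_ring sum_distrib_left sum_distrib_right power_mult_distrib power_add mult_ac)
      also have "\<dots> = (\<Sum>i\<le>?n. (of_nat (?n choose i) * a ^ i * z ^ (?n - i)) * ?S (i + k))"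
        by (subst sum.swap) (simp only: sum_distrib_left)
      finally show ?thesis by (simp add: mult_ac)
    qed
    finally show ?thesis
      by (simp add: H_def poly_sum mult_ac)
  qed
  ultimately show thesis using that by blast
qed

text \<open>
  The code lifted to vectors. The functional \<open>u = 0\<close> contributes the constant functions, and the
  value at the vector \<open>0\<close> is arbitrary.
\<close>

definition hyp_comb :: "('f::{field,finite} ^ 'm::finite \<Rightarrow> 'k::field) set" where
  "hyp_comb = {f. \<exists>a. \<forall>v. v \<noteq> 0 \<longrightarrow> f v = (\<Sum>u\<in>UNIV. if dotp u v = 0 then a u else 0)}"

lemma hyp_comb_scale:
  assumes "f \<in> hyp_comb" "c \<noteq> 0"
  shows "f (c *s v) = f v"
proof (cases "v = 0")
  case False
  obtain a where a: "\<And>v. v \<noteq> 0 \<Longrightarrow> f v = (\<Sum>u\<in>UNIV. if dotp u v = 0 then a u else 0)"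
    using assms(1) by (auto simp: hyp_comb_def)
  have "c *s v \<noteq> 0" using False assms(2) by simp
  then show ?thesis using a False assms(2) by (simp add: dotp_simps)
qed simp

lemma hyp_comb_diff:
  assumes "f \<in> hyp_comb"
  shows "(\<lambda>v. f v - (if dotp u v = 0 then b else 0)) \<in> hyp_comb"
proof -
  obtain a where a: "\<And>v. v \<noteq> 0 \<Longrightarrow> f v = (\<Sum>u\<in>UNIV. if dotp u v = 0 then a u else 0)"
    using assms(1) by (auto simp: hyp_comb_def)
  have "f v - (if dotp u v = 0 then b else 0)
      = (\<Sum>w\<in>UNIV. if dotp w v = 0 then a w - (if w = u then b else 0) else 0)" if "v \<noteq> 0" for v
  proof -
    have "(\<Sum>w\<in>UNIV. if dotp w v = 0 then a w - (if w = u then b else 0) else 0)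
      = (\<Sum>w\<in>UNIV. (if dotp w v = 0 then a w else 0) - (if w = u then (if dotp u v = 0 then b else 0) else 0))"
      by (intro sum.cong) auto
    also have "\<dots> = f v - (if dotp u v = 0 then b else 0)"
      by (simp add: sum_subtractf a[OF that] sum.delta)
    finally show ?thesis by simp
  qed
  then show ?thesis
    unfolding hyp_comb_def
    by (intro CollectI exI[of _ "\<lambda>w. a w - (if w = u then b else 0)"] allI impI)
qed

section \<open>Transfer of coefficients from the prime field to \<open>'f\<close>\<close>

lemma CHAR_eq_of_card_prime_power:
  fixes p h :: nat
  assumes "prime p" "CARD('f::{field,finite}) = p ^ h"
  shows "CHAR('f) = p"
proof -
  have "CHAR('f) > 0"
    by (rule finite_imp_CHAR_pos) auto
  then have "prime CHAR('f)"
    by (rule prime_CHAR_semidom)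
  moreover have "CHAR('f) dvd p ^ h"
  proof -
    have "of_nat CARD('f) = (0::'f)"
      using sum_field_power_eq_0[of 0, where 'f='f] card_field_gt_1[where 'f='f] by simp
    then show ?thesis by (simp only: of_nat_eq_0_iff_char_dvd assms)
  qed
  ultimately show ?thesis
    using assms(1) by (metis prime_dvd_power primes_dvd_imp_eq)
qed

lemma prime_field_of_nat:
  fixes x :: "'k::{field,finite}"
  assumes "prime CARD('k)"
  obtains n where "x = of_nat n"
proof -
  have char: "CHAR('k) = CARD('k)"
    using CHAR_eq_of_card_prime_power[where 'f='k and h=1, OF assms] by simp
  have "inj_on (of_nat :: nat \<Rightarrow> 'k) {..<CARD('k)}"
    by (rule linorder_inj_onI') (auto simp: of_nat_eq_iff_char_dvd char dest: dvd_imp_le)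
  then have "card ((of_nat :: nat \<Rightarrow> 'k) ` {..<CARD('k)}) = CARD('k)"
    by (simp add: card_image)
  then have "(of_nat :: nat \<Rightarrow> 'k) ` {..<CARD('k)} = UNIV"
    by (intro card_subset_eq) auto
  then show thesis using that by blast
qed

text \<open>The lines are indexed by \<open>y\<close> and parametrised by \<open>x\<close>. The
  moments of a combination of hyperplanes are combinations of those of single affine equations,
  which have the required degree. The vector 0 is avoided, as members of \<open>hyp_comb\<close> are
  arbitrary there.\<close>

lemma affine_plane_bound:
  fixes f :: "'f::{field,finite} ^ 'm::finite \<Rightarrow> 'k::{field,finite}" and p h :: nat
  assumes p: "prime p" "CARD('f) = p ^ h" "CARD('k) = p"
    and f: "f \<in> hyp_comb"
    and nz: "\<And>x y. x *s R + B + y *s C \<noteq> 0"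
    and n: "n = card {x. f (x *s R + B + y\<^sub>0 *s C) \<noteq> 0}"
  shows "(\<Sum>y\<in>UNIV. n - card {x. f (x *s R + B + y *s C) \<noteq> 0}) \<le> n * (n - 1)"
proof -
  obtain a where a: "\<And>v. v \<noteq> 0 \<Longrightarrow> f v = (\<Sum>u\<in>UNIV. if dotp u v = 0 then a u else 0)"
    using f by (auto simp: hyp_comb_def)
  \<comment> \<open>\<open>'k\<close> and \<open>'f\<close> are distinct types of the same
    characteristic \<open>p\<close>. Coefficients lifted to natural numbers can be read in
    \<open>'f\<close>, and \<open>F\<close> has the same zeros as \<open>f\<close>.\<close>
  have "\<exists>m. a u = of_nat m" for u
    using prime_field_of_nat[where 'k='k] p by metis
  then obtain N where N: "\<And>u. a u = of_nat (N u)" by metis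
  define F :: "'f \<Rightarrow> 'f \<Rightarrow> 'f" where
    "F = (\<lambda>x y. \<Sum>u\<in>UNIV. of_nat (N u) * (if dotp u (x *s R + B + y *s C) = 0 then 1 else 0))"
  have char: "CHAR('f) = p" "CHAR('k) = p"
    using CHAR_eq_of_card_prime_power[where 'f='f, OF p(1) p(2)]
      CHAR_eq_of_card_prime_power[where 'f='k and h=1, OF p(1)] p by simp_all
  have F_iff: "F x y \<noteq> 0 \<longleftrightarrow> f (x *s R + B + y *s C) \<noteq> 0" for x y
  proof -
    let ?v = "x *s R + B + y *s C"
    let ?m = "\<Sum>u\<in>UNIV. if dotp u ?v = 0 then N u else 0"
    have "f ?v = of_nat ?m"
      unfolding a[OF nz] N of_nat_sum by (intro sum.cong) auto
    moreover have "F x y = of_nat ?m"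
      unfolding F_def of_nat_sum by (intro sum.cong) auto
    ultimately show ?thesis by (simp only: of_nat_eq_0_iff_char_dvd char)
  qed
  define Q where "Q = (\<lambda>u (H :: nat \<Rightarrow> 'f poly). (\<forall>k. degree (H k) \<le> k) \<and>
    (\<forall>k y. poly (H k) y
      = (\<Sum>x\<in>UNIV. (if dotp u R * x + dotp u B + dotp u C * y = 0 then 1 else 0) * x ^ k)))"
  have "\<exists>H. Q u H" for u
    by (rule affine_zero_moments[of "dotp u R" "dotp u B" "dotp u C"]) (auto simp: Q_def)
  then obtain H where "\<And>u. Q u (H u)" by metis
  then have degH: "\<And>u k. degree (H u k) \<le> k"
    and H: "\<And>u k y. poly (H u k) y
      = (\<Sum>x\<in>UNIV. (if dotp u R * x + dotp u B + dotp u C * y = 0 then 1 else 0) * x ^ k)"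
    unfolding Q_def by blast+
  define G where "G = (\<lambda>k. \<Sum>u\<in>UNIV. smult (of_nat (N u)) (H u k))"
  have "(\<Sum>y\<in>UNIV. n - card {x. F x y \<noteq> 0}) \<le> n * (n - 1)"
  proof (rule hankel_bound)
    show "degree (G k) \<le> k" for k
      unfolding G_def by (intro degree_sum_le) (auto simp: degH)
    show "poly (G k) y = (\<Sum>x\<in>UNIV. F x y * x ^ k)" for k y
    proof -
      let ?I = "\<lambda>u x. if dotp u (x *s R + B + y *s C) = 0 then 1 else (0::'f)"
      have I: "?I u x = (if dotp u R * x + dotp u B + dotp u C * y = 0 then 1 else 0)" for u x
        by (simp add: dotp_simps mult.commute)
      have "poly (G k) y = (\<Sum>u\<in>UNIV. \<Sum>x\<in>UNIV. of_nat (N u) * ?I u x * x ^ k)"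
        unfolding G_def poly_sum poly_smult H I by (simp only: sum_distrib_left mult.assoc)
      also have "\<dots> = (\<Sum>x\<in>UNIV. F x y * x ^ k)"
        unfolding F_def by (subst sum.swap) (simp only: sum_distrib_right)
      finally show ?thesis .
    qed
    show "n = card {x. F x y\<^sub>0 \<noteq> 0}"
      unfolding F_iff n ..
  qed
  then show ?thesis unfolding F_iff .
qed

text \<open>For fixed \<open>y\<close> the vectors \<open>x *s R + B + y *s C\<close> represent the
  points other than \<open>R\<close> of a line through \<open>R\<close>; \<open>y = 0\<close> gives
  the line \<open>vec.span {B, R}\<close>. After subtraction of \<open>f R\<close> this line has
  exactly \<open>s\<close> nonzero values, and the deficits of the other lines sum to at most
  \<open>s * (s - 1)\<close>. So the other \<open>q - 1\<close> lines carry at least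
  \<open>(q - 1) * s - s * (s - 1) = s * (q - s)\<close> support points.\<close>

lemma plane_bound:
  fixes f :: "'f::{field,finite} ^ 'm::finite \<Rightarrow> 'k::{field,finite}" and p h :: nat
  assumes p: "prime p" "CARD('f) = p ^ h" "CARD('k) = p"
    and f: "f \<in> hyp_comb"
    and R: "R \<noteq> 0" and B: "B \<notin> vec.span {R}" and C: "C \<notin> vec.span {B, R}"
    and s: "s = card {x. f (x *s R + B) \<noteq> f R}"
  shows "(CARD('f) - 1) * (s * (CARD('f) - s))
    \<le> card {v \<in> vec.span {C, B, R} - vec.span {B, R}. f v \<noteq> 0}"
proof -
  let ?q = "CARD('f)"
  obtain u where u: "\<forall>w\<in>vec.span {B, R}. dotp u w = 0" "dotp u C = 1"
    using separating_functional[OF vec.subspace_span C] by blast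
  obtain w where w: "\<forall>v\<in>vec.span {R}. dotp w v = 0" "dotp w B = 1"
    using separating_functional[OF vec.subspace_span B] by blast
  have BR: "B \<in> vec.span {B, R}" "R \<in> vec.span {B, R}" "R \<in> vec.span {R}"
    by (auto intro: vec.span_base)
  then have uB: "dotp u B = 0" and uR: "dotp u R = 0" and wR: "dotp w R = 0"
    using u w by auto
  have u_eq: "dotp u (x *s R + B + y *s C) = y" for x y
    by (simp add: dotp_simps uB uR u)
  have w_eq: "dotp w (x *s R + B + y *s C) = 1 + y * dotp w C" for x y
    by (simp add: dotp_simps wR w)
  \<comment> \<open>The hyperplane \<open>u = 0\<close> meets the plane in the line
    \<open>y = 0\<close>, so the values at the other points of the plane are unchanged.\<close>
  define g where "g = (\<lambda>v. f v - (if dotp u v = 0 then f R else 0))"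
  have g: "g \<in> hyp_comb"
    unfolding g_def by (rule hyp_comb_diff[OF f])
  define S where "S = (\<lambda>y. {x. g (x *s R + B + y *s C) \<noteq> 0})"
  have nz: "x *s R + B + y *s C \<noteq> 0" for x y
  proof
    assume *: "x *s R + B + y *s C = 0"
    have "y = 0" using u_eq[of x y] unfolding * by (simp add: dotp_simps)
    then show False using w_eq[of x y] unfolding * by (simp add: dotp_simps)
  qed
  have s0: "s = card (S 0)"
    using u_eq[of _ 0] by (simp add: s S_def g_def)
  have Sy: "S y = {x. f (x *s R + B + y *s C) \<noteq> 0}" if "y \<noteq> 0" for y
    using that by (simp add: S_def g_def u_eq)
  have "s \<le> ?q" unfolding s by (rule card_mono) auto
  have "(\<Sum>y\<in>UNIV. s - card (S y)) \<le> s * (s - 1)"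
    unfolding S_def
    by (rule affine_plane_bound[OF p g nz, of _ 0]) (use s0 in \<open>simp add: S_def\<close>)
  moreover have "(\<Sum>y\<in>UNIV. s - card (S y)) = (\<Sum>y\<in>UNIV - {0}. s - card (S y))"
    by (rule sum.mono_neutral_right) (auto simp: s0)
  moreover have "(\<Sum>y\<in>UNIV - {0::'f}. s) \<le> (\<Sum>y\<in>UNIV - {0}. (s - card (S y)) + card (S y))"
    by (intro sum_mono) simp
  ultimately have "(?q - 1) * s \<le> s * (s - 1) + (\<Sum>y\<in>UNIV - {0}. card (S y))"
    by (simp add: sum.distrib card_Diff_singleton)
  moreover have "s * (?q - s) + s * (s - 1) = (?q - 1) * s"
  proof (cases "s = 0")
    case False
    then have "s * (?q - s) + s * (s - 1) = s * ((?q - s) + (s - 1))"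
      by (simp add: algebra_simps)
    also have "(?q - s) + (s - 1) = ?q - 1" using False \<open>s \<le> ?q\<close> by simp
    finally show ?thesis by simp
  qed simp
  ultimately have le: "s * (?q - s) \<le> (\<Sum>y\<in>UNIV - {0}. card (S y))" by linarith
  \<comment> \<open>Passage from points to vectors by a nonzero scalar \<open>c\<close>; the
    functionals \<open>u\<close> and \<open>w\<close> recover \<open>c\<close> and \<open>y\<close>
    from the vector.\<close>
  define T where "T = (UNIV - {0::'f}) \<times> (SIGMA y:UNIV - {0}. S y)"
  define \<phi> where "\<phi> = (\<lambda>(c, y, x). c *s (x *s R + B + y *s C))"
  have "card T = (?q - 1) * (\<Sum>y\<in>UNIV - {0}. card (S y))"
    by (simp add: T_def card_cartesian_product card_SigmaI card_Diff_singleton)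
  moreover have "card T = card (\<phi> ` T)"
  proof (rule card_image[symmetric])
    show "inj_on \<phi> T"
    proof (rule inj_onI)
      fix z z' assume z: "z \<in> T" "z' \<in> T" and eq: "\<phi> z = \<phi> z'"
      obtain c y x c' y' x' where zz: "z = (c, y, x)" "z' = (c', y', x')"
        by (metis prod_cases3)
      have c: "c \<noteq> 0" "c' \<noteq> 0" using z by (auto simp: T_def zz)
      have eq: "c *s (x *s R + B + y *s C) = c' *s (x' *s R + B + y' *s C)"
        using eq by (simp add: zz \<phi>_def)
      have "c * y = c' * y'"
        using arg_cong[OF eq, of "dotp u"] by (simp only: dotp_scale_right u_eq)
      moreover have "c * (1 + y * dotp w C) = c' * (1 + y' * dotp w C)"
        using arg_cong[OF eq, of "dotp w"] by (simp only: dotp_scale_right w_eq)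
      ultimately have "c = c'"
        by (simp add: distrib_left flip: mult.assoc)
      with \<open>c * y = c' * y'\<close> c have "y = y'" by simp
      have "x *s R = x' *s R" using eq c \<open>c = c'\<close> \<open>y = y'\<close> by simp
      then have "x = x'" using R by simp
      show "z = z'" using zz \<open>c = c'\<close> \<open>y = y'\<close> \<open>x = x'\<close> by simp
    qed
  qed
  moreover have "card (\<phi> ` T) \<le> card {v \<in> vec.span {C, B, R} - vec.span {B, R}. f v \<noteq> 0}"
  proof (rule card_mono[OF finite], rule subsetI)
    fix v assume "v \<in> \<phi> ` T"
    then obtain c x y where c: "c \<noteq> 0" and y: "y \<noteq> 0" and x: "x \<in> S y"
      and v: "v = c *s (x *s R + B + y *s C)"
      by (auto simp: T_def \<phi>_def)
    have "R \<in> vec.span {C, B, R}" "B \<in> vec.span {C, B, R}" "C \<in> vec.span {C, B, R}"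
      by (auto intro: vec.span_base)
    then have "v \<in> vec.span {C, B, R}"
      unfolding v by (intro vec.span_scale vec.span_add)
    moreover have "dotp u v \<noteq> 0"
      using c y by (simp only: v dotp_scale_right u_eq) simp
    then have "v \<notin> vec.span {B, R}" using u by blast
    moreover have "f v \<noteq> 0"
      using x y c by (simp add: v Sy hyp_comb_scale[OF f])
    ultimately show "v \<in> {v \<in> vec.span {C, B, R} - vec.span {B, R}. f v \<noteq> 0}" by simp
  qed
  ultimately have "(?q - 1) * (\<Sum>y\<in>UNIV - {0}. card (S y))
      \<le> card {v \<in> vec.span {C, B, R} - vec.span {B, R}. f v \<noteq> 0}"
    by simp
  with le show ?thesis by (meson le_trans mult_le_mono2)
qed

section \<open>Dominating values\<close>

lemma card_less_obtain:
  assumes "finite A" "card A < card B"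
  obtains x where "x \<in> B" "x \<notin> A"
  using assms by (meson card_mono leD subsetI)

lemma span_insert_span: "vec.span (insert v (vec.span S)) = vec.span (insert v S)"
  by (simp add: vec.span_insert vec.span_span)

text \<open>The \<open>itself\<close> parameters fix the types. The bound \<open>h \<ge> 2\<close>
  enters as \<open>p\<^sup>2 \<le> q\<close>.\<close>

locale code_setting =
  fixes p h q :: nat and F :: "'f::{field,finite} itself" and K :: "'k::{field,finite} itself"
  assumes prime_p: "prime p" and card_F: "CARD('f) = q" and q_def: "q = p ^ h"
    and card_K: "CARD('k) = p" and h_ge_2: "2 \<le> h"
begin

lemma q_gt_1: "1 < q"
  using card_field_gt_1[where 'f='f] card_F by simp

lemma p_square_le: "p\<^sup>2 \<le> q"
  unfolding q_def using prime_p h_ge_2 by (intro power_increasing) (auto dest: prime_gt_0_nat)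

text \<open>For \<open>f\<close> lifted from a codeword, \<open>dev f 0\<close> is
  \<open>q - 1\<close> times the weight on the subspace; a small \<open>dev f \<alpha> U\<close>
  means that \<open>\<alpha>\<close> dominates on \<open>U\<close>.\<close>

definition dev :: "('f ^ 'm::finite \<Rightarrow> 'k) \<Rightarrow> 'k \<Rightarrow> ('f ^ 'm) set \<Rightarrow> nat" where
  "dev f \<alpha> U = card {v \<in> U - {0}. f v \<noteq> \<alpha>}"

lemma dev_complement:
  assumes "vec.subspace (U :: ('f ^ 'm::finite) set)"
  shows "card {v \<in> U - {0}. f v = \<alpha>} + dev f \<alpha> U + 1 = card U"
proof -
  have "card U = card (U - {0}) + 1"
    using assms by (simp add: card_Diff_singleton vec.subspace_0 card_gt_0_iff) (metis card_gt_0_iff empty_iff finite vec.subspace_0 Suc_pred)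
  moreover have "card (U - {0}) = card {v \<in> U - {0}. f v = \<alpha>} + dev f \<alpha> U"
    unfolding dev_def by (subst card_Un_disjoint[symmetric]) (auto intro: arg_cong[of _ _ card])
  ultimately show ?thesis by simp
qed

text \<open>The plane inequality without coordinates: \<open>s\<close> is the number of points of
  \<open>L\<close> with a value other than that of \<open>R\<close>, and the same \<open>s\<close>
  serves all planes through \<open>L\<close>.\<close>

lemma line_point:
  fixes f :: "'f ^ 'm::finite \<Rightarrow> 'k"
  assumes f: "f \<in> hyp_comb" and L: "vec.subspace L" "card L = q\<^sup>2" and R: "R \<in> L" "R \<noteq> 0"
  obtains s where "dev f (f R) L = (q - 1) * s" "s \<le> q"
    and "\<And>C. C \<notin> L \<Longrightarrow> (q - 1) * (s * (q - s)) \<le> card {v \<in> vec.span (insert C L) - L. f v \<noteq> 0}"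
proof -
  have "card (vec.span {R}) < card L"
    using q_gt_1 by (simp add: card_span_singleton R L card_F power2_eq_square)
  then obtain B where B: "B \<in> L" "B \<notin> vec.span {R}"
    by (rule card_less_obtain[OF finite])
  have span: "vec.span {B, R} = L"
    using span_pair_eq[of L R B] L R B by (simp add: card_F)
  obtain w where w: "\<forall>v\<in>vec.span {R}. dotp w v = 0" "dotp w B = 1"
    using separating_functional[OF vec.subspace_span B(2)] by blast
  have wR: "dotp w R = 0" using w by (simp add: vec.span_base)
  define X where "X = {x. f (x *s R + B) \<noteq> f R}"
  \<comment> \<open>The vectors of \<open>L\<close> outside the span of \<open>R\<close> are
    \<open>c *s (x *s R + B)\<close> with \<open>c \<noteq> 0\<close>, each once; nonzero vectors in
    the span of \<open>R\<close> do not deviate.\<close>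
  define \<phi> where "\<phi> = (\<lambda>(c, x). c *s (x *s R + B))"
  have w_eq: "dotp w (c *s (x *s R + B)) = c" for c x
    by (simp add: dotp_simps wR w)
  have "inj_on \<phi> ((UNIV - {0}) \<times> X)"
  proof (rule inj_onI)
    fix z z' assume z: "z \<in> (UNIV - {0}) \<times> X" "z' \<in> (UNIV - {0}) \<times> X" "\<phi> z = \<phi> z'"
    obtain c x d y where zz: "z = (c, x)" "z' = (d, y)" by (metis surj_pair)
    have eq: "c *s (x *s R + B) = d *s (y *s R + B)" using z by (simp add: \<phi>_def zz)
    have "c = d" using arg_cong[OF eq, of "dotp w"] by (simp only: w_eq)
    with eq z zz have "x *s R = y *s R" by auto
    then show "z = z'" using R \<open>c = d\<close> zz by simp
  qed
  then have "card (\<phi> ` ((UNIV - {0}) \<times> X)) = (q - 1) * card X"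
    by (simp add: card_image card_cartesian_product card_Diff_singleton card_F)
  moreover have "\<phi> ` ((UNIV - {0}) \<times> X) = {v \<in> L - {0}. f v \<noteq> f R}"
  proof (rule subset_antisym; rule subsetI)
    fix v assume "v \<in> \<phi> ` ((UNIV - {0}) \<times> X)"
    then obtain c x where c: "c \<noteq> 0" "x \<in> X" and v: "v = c *s (x *s R + B)"
      by (auto simp: \<phi>_def)
    have "v \<in> L" unfolding v using L R B by (intro vec.subspace_scale vec.subspace_add)
    moreover have "v \<noteq> 0"
    proof
      assume "v = 0"
      then have "dotp w v = 0" by (simp add: dotp_zero_right)
      then show False using w_eq[of c x] c unfolding v by simp
    qed
    moreover have "f v \<noteq> f R" using c by (simp add: v X_def hyp_comb_scale[OF f])
    ultimately show "v \<in> {v \<in> L - {0}. f v \<noteq> f R}" by simp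
  next
    fix v assume v: "v \<in> {v \<in> L - {0}. f v \<noteq> f R}"
    then have "v \<in> vec.span (insert B (vec.span {R}))" using span by (simp add: span_insert_span)
    then obtain a b where v_eq: "v = a *s R + b *s B"
      unfolding span_insert_subspace[OF vec.subspace_span] by (auto simp: vec.span_singleton)
    have "b \<noteq> 0"
    proof
      assume "b = 0"
      then have "v = a *s R" "a \<noteq> 0" using v v_eq by auto
      then show False using v hyp_comb_scale[OF f] by auto
    qed
    then have v_eq': "v = b *s ((a / b) *s R + B)"
      by (simp add: v_eq vec.scale_right_distrib)
    then have "f ((a / b) *s R + B) = f v"
      using hyp_comb_scale[OF f \<open>b \<noteq> 0\<close>] by metis
    then have "(b, a / b) \<in> (UNIV - {0}) \<times> X"
      using v \<open>b \<noteq> 0\<close> by (simp add: X_def)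
    moreover have "v = \<phi> (b, a / b)" using v_eq' by (simp add: \<phi>_def)
    ultimately show "v \<in> \<phi> ` ((UNIV - {0}) \<times> X)" by blast
  qed
  ultimately have "dev f (f R) L = (q - 1) * card X" by (simp add: dev_def)
  moreover have "card X \<le> q" unfolding card_F[symmetric] by (rule card_mono) auto
  moreover have "(q - 1) * (card X * (q - card X)) \<le> card {v \<in> vec.span (insert C L) - L. f v \<noteq> 0}"
    if "C \<notin> L" for C
  proof -
    have "vec.span {C, B, R} = vec.span (insert C L)"
      unfolding span[symmetric] span_insert_span ..
    moreover have "CARD('f) = p ^ h" by (simp add: card_F q_def)
    ultimately show ?thesis
      using plane_bound[OF prime_p _ card_K f R(2) B(2), where C=C and h=h] that
      unfolding span card_F X_def by simp
  qed
  ultimately show thesis using that by blast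
qed

text \<open>The product \<open>s * (q - s)\<close> is smallest at the ends of the range, where it is
  \<open>(e + 1) * (q - (e + 1)) = e * q + 2 * e + 3 + (q - (e + 2)\<^sup>2)\<close>. Compared with
  \<open>e * (q * Q - 1) = e * q * (Q - 1) + e * (q - 1)\<close> the surplus suffices because
  \<open>q \<le> Q\<close>.\<close>

lemma line_gap_arith:
  fixes e s Q :: nat
  assumes e: "(e + 2)\<^sup>2 \<le> q" and s: "e < s" "s + e < q" and Q: "q \<le> Q"
  shows "e * (q * Q - 1) < (Q - 1) * (s * (q - s))"
proof -
  define r where "r = q - (s + e + 1)"
  have r: "q = s + e + 1 + r" using s by (simp add: r_def)
  define t where "t = s - (e + 1)"
  have t: "s = e + 1 + t" using s by (simp add: t_def)
  have "(e + 1) * (q - (e + 1)) \<le> s * (q - s)"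
  proof -
    have "s * (q - s) = (e + 1 + t) * (e + 1 + r)" by (simp add: r t)
    moreover have "(e + 1) * (q - (e + 1)) = (e + 1) * (t + e + 1 + r)" by (simp add: r t)
    moreover have "(e + 1 + t) * (e + 1 + r) = (e + 1) * (t + e + 1 + r) + t * r"
      by (simp add: algebra_simps)
    ultimately show ?thesis by simp
  qed
  then have *: "(Q - 1) * ((e + 1) * (q - (e + 1))) \<le> (Q - 1) * (s * (q - s))"
    by (rule mult_le_mono2)
  define x where "x = q - (e + 2)\<^sup>2"
  define w where "w = (e + 1) * (e + 1) + (e + 1) + 1 + x"
  have "(e + 2)\<^sup>2 = (e + 1) + ((e + 1) * (e + 1) + (e + 1) + 1)"
    by (simp add: power2_eq_square)
  then have x: "q = (e + 1) + w"
    using e unfolding w_def x_def by linarith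
  define y where "y = Q - q"
  have y: "Q = q + y" using Q by (simp add: y_def)
  define z where "z = q - 1"
  have z: "q = z + 1" using q_gt_1 by (simp add: z_def)
  have 1: "(e + 1) * (q - (e + 1)) = e * q + (2 * e + 3 + x)"
  proof -
    have "(e + 1) * w = e * ((e + 1) + w) + (2 * e + 3 + x)"
      by (simp add: w_def algebra_simps)
    then show ?thesis unfolding x by simp
  qed
  have 2: "Q - 1 = z + y" by (simp add: y z)
  have "q * Q - 1 = q * (z + y) + z"
    unfolding y by (simp add: z algebra_simps)
  then have "e * (q * Q - 1) = e * q * (z + y) + e * z" by (simp add: algebra_simps)
  moreover have "(Q - 1) * ((e + 1) * (q - (e + 1))) = e * q * (z + y) + (2 * e + 3 + x) * (z + y)"
    unfolding 1 2 by (simp add: algebra_simps)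
  moreover have "e * z < (2 * e + 3 + x) * (z + y)"
  proof -
    have "z > 0" using z q_gt_1 by simp
    then have "e * z < (2 * e + 3 + x) * z" by (intro mult_less_mono1) auto
    also have "\<dots> \<le> (2 * e + 3 + x) * (z + y)" by (rule mult_le_mono2) simp
    finally show ?thesis .
  qed
  ultimately show ?thesis using * by linarith
qed

text \<open>Averages the plane inequality over the planes of \<open>V\<close> through
  \<open>L\<close>: an intermediate \<open>s\<close> would force more support off \<open>L\<close>
  than the weight allows. Here \<open>d\<close> is the projective dimension of \<open>V\<close>, and
  \<open>q ^ d - 1\<close> is the number of nonzero vectors of a hyperplane of
  \<open>V\<close>.\<close>

lemma line_gap:
  fixes f :: "'f ^ 'm::finite \<Rightarrow> 'k"
  assumes f: "f \<in> hyp_comb" and e: "(e + 2)\<^sup>2 \<le> q"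
    and V: "vec.subspace V" "card V = q ^ Suc d" "2 \<le> d" and wt: "dev f 0 V \<le> e * (q ^ d - 1)"
    and L: "vec.subspace L" "L \<subseteq> V" "card L = q\<^sup>2" and R: "R \<in> L" "R \<noteq> 0"
  obtains s where "dev f (f R) L = (q - 1) * s" "s \<le> e \<or> q \<le> s + e"
proof -
  obtain s where s: "dev f (f R) L = (q - 1) * s" "s \<le> q"
    and plane: "\<And>C. C \<notin> L \<Longrightarrow> (q - 1) * (s * (q - s)) \<le> card {v \<in> vec.span (insert C L) - L. f v \<noteq> 0}"
    using line_point[OF f L(1,3) R] by blast
  have "s \<le> e \<or> q \<le> s + e"
  proof (rule ccontr)
    assume "\<not> ?thesis"
    then have es: "e < s" "s + e < q" by auto
    obtain i where d: "d = i + 2" using V(3) by (metis le_Suc_ex add.commute)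
    define Q where "Q = q ^ Suc i"
    have Q: "q \<le> Q" unfolding Q_def using q_gt_1 by simp
    have cardV: "card V = q * q * Q" "q ^ d = q * Q"
      using V(2) by (simp_all add: d Q_def)
    have "(\<Sum>w\<in>V - L. (q - 1) * (s * (q - s))) \<le> (\<Sum>w\<in>V - L. card {v \<in> vec.span (insert w L) - L. f v \<noteq> 0})"
      by (intro sum_mono plane) auto
    also have "\<dots> = (q - 1) * q\<^sup>2 * card {v \<in> V - L. f v \<noteq> 0}"
      using sum_card_span_insert[OF L(1) L(1) _ V(1) L(2), of "\<lambda>v. f v \<noteq> 0"] by (simp add: card_F L)
    also have "card {v \<in> V - L. f v \<noteq> 0} \<le> dev f 0 V"
      unfolding dev_def using vec.subspace_0[OF L(1)] by (intro card_mono) auto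
    also note wt
    also have "card (V - L) = q\<^sup>2 * (Q - 1)"
      using L(2) by (simp add: card_Diff_subset L(3) cardV power2_eq_square diff_mult_distrib2)
    then have "(\<Sum>w\<in>V - L. (q - 1) * (s * (q - s))) = (q - 1) * q\<^sup>2 * ((Q - 1) * (s * (q - s)))"
      by (simp add: mult_ac)
    finally have "(q - 1) * q\<^sup>2 * ((Q - 1) * (s * (q - s))) \<le> (q - 1) * q\<^sup>2 * (e * (q * Q - 1))"
      by (simp add: cardV)
    then have "(Q - 1) * (s * (q - s)) \<le> e * (q * Q - 1)"
      using q_gt_1 by simp
    then show False using line_gap_arith[OF e es Q] by simp
  qed
  with s that show thesis by blast
qed

lemma p_mult_less:
  assumes "(e + 2)\<^sup>2 \<le> q"
  shows "p * (e + 1) < q + 1"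
proof -
  have "p\<^sup>2 * (e + 2)\<^sup>2 \<le> q * q"
    by (rule mult_le_mono[OF p_square_le assms])
  then have "(p * (e + 2))\<^sup>2 \<le> q\<^sup>2"
    by (simp only: power_mult_distrib power2_eq_square[of q])
  then have "p * (e + 2) \<le> q" by (simp only: power2_nat_le_eq_le)
  then show ?thesis by simp
qed

text \<open>If no value dominates, every value that occurs on \<open>L\<close> is missed by at least
  \<open>q - e\<close> of the \<open>q + 1\<close> points, hence is taken on at most
  \<open>e + 1\<close> of them. The \<open>p\<close> values then account for at most
  \<open>p * (e + 1) < q + 1\<close> points.\<close>

lemma line_dominated:
  fixes f :: "'f ^ 'm::finite \<Rightarrow> 'k"
  assumes f: "f \<in> hyp_comb" and e: "(e + 2)\<^sup>2 \<le> q"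
    and V: "vec.subspace V" "card V = q ^ Suc d" "2 \<le> d" and wt: "dev f 0 V \<le> e * (q ^ d - 1)"
    and L: "vec.subspace L" "L \<subseteq> V" "card L = q\<^sup>2"
  obtains \<alpha> where "dev f \<alpha> L \<le> (q - 1) * e"
proof (rule ccontr)
  assume "\<not> thesis"
  then have no: "(q - 1) * e < dev f \<alpha> L" for \<alpha> using that by (meson not_le)
  have "card {v \<in> L - {0}. f v = \<alpha>} \<le> (q - 1) * (e + 1)" for \<alpha>
  proof (cases "\<exists>R\<in>L - {0}. f R = \<alpha>")
    case True
    then obtain R where R: "R \<in> L" "R \<noteq> 0" "f R = \<alpha>" by auto
    obtain s where s: "dev f \<alpha> L = (q - 1) * s" "s \<le> e \<or> q \<le> s + e"
      using line_gap[OF f e V wt L R(1,2)] R(3) by metis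
    have "\<not> s \<le> e" using no[of \<alpha>] s(1) by (metis linorder_not_less mult_le_mono2)
    then have "(q - 1) * q \<le> (q - 1) * (s + e)" using s(2) by simp
    moreover have "card {v \<in> L - {0}. f v = \<alpha>} + (q - 1) * s + 1 = q * q"
      using dev_complement[OF L(1), of f \<alpha>] by (simp add: s(1) L(3) power2_eq_square)
    moreover have "q * q = (q - 1) * q + (q - 1) + 1"
      using q_gt_1 by (cases q) auto
    ultimately show ?thesis by (simp add: distrib_left)
  next
    case False
    then have empty: "{v \<in> L - {0}. f v = \<alpha>} = {}" by auto
    show ?thesis unfolding empty by simp
  qed
  then have "(\<Sum>\<alpha>\<in>UNIV. card {v \<in> L - {0}. f v = \<alpha>}) \<le> (\<Sum>\<alpha>\<in>(UNIV::'k set). (q - 1) * (e + 1))"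
    by (intro sum_mono) auto
  moreover have "(\<Sum>\<alpha>\<in>UNIV. card {v \<in> L - {0}. f v = \<alpha>}) = card (\<Union>\<alpha>. {v \<in> L - {0}. f v = \<alpha>})"
    by (rule card_UN_disjoint[symmetric]) auto
  moreover have "(\<Union>\<alpha>. {v \<in> L - {0}. f v = \<alpha>}) = L - {0}" by auto
  moreover have "card (L - {0}) = (q - 1) * (q + 1)"
    using vec.subspace_0[OF L(1)] q_gt_1 by (simp add: card_Diff_singleton L(3) power2_eq_square algebra_simps)
  ultimately have "(q - 1) * (q + 1) \<le> p * ((q - 1) * (e + 1))"
    by (simp only: card_K sum_constant of_nat_id)
  also have "\<dots> = (q - 1) * (p * (e + 1))" by (simp only: mult_ac)
  finally have "q + 1 \<le> p * (e + 1)"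
    by (rule nat_mult_le_cancel1[THEN iffD1, rotated]) (use q_gt_1 in simp)
  then show False using p_mult_less[OF e] by simp
qed

text \<open>Among the lines through a support point take one, \<open>L\<close>, with the most
  support points, say \<open>s\<close>. If no line is dominated by a nonzero value then
  \<open>s \<le> e\<close>, and each of the other \<open>q\<close> lines through the point has at
  most \<open>s - 1\<close> further support points. The plane inequality gives
  \<open>s * (q - s) \<le> q * (s - 1)\<close>, so \<open>q \<le> s * s \<le> e * e\<close>, a
  contradiction.\<close>

lemma plane_heavy_line:
  fixes f :: "'f ^ 'm::finite \<Rightarrow> 'k"
  assumes f: "f \<in> hyp_comb" and e: "(e + 2)\<^sup>2 \<le> q"
    and V: "vec.subspace V" "card V = q ^ 3" and wt: "dev f 0 V \<le> e * (q\<^sup>2 - 1)"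
    and v\<^sub>0: "v\<^sub>0 \<in> V" "v\<^sub>0 \<noteq> 0" "f v\<^sub>0 \<noteq> 0"
  obtains L \<alpha> where "vec.subspace L" "L \<subseteq> V" "card L = q\<^sup>2" "\<alpha> \<noteq> 0" "dev f \<alpha> L \<le> (q - 1) * e"
proof (rule ccontr)
  assume no: "\<not> thesis"
  define K where "K = vec.span {v\<^sub>0}"
  have K: "vec.subspace K" "K \<subseteq> V" "card K = q" "v\<^sub>0 \<in> K"
    unfolding K_def using V v\<^sub>0
    by (simp_all add: card_span_singleton card_F vec.span_base vec.span_minimal)
  have line: "vec.subspace (vec.span (insert w K))" "vec.span (insert w K) \<subseteq> V"
    "card (vec.span (insert w K)) = q\<^sup>2" if "w \<in> V - K" for w
    using that K V card_span_insert[OF K(1), of w]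
    by (simp_all add: card_F power2_eq_square vec.span_minimal)
  have V': "card V = q ^ Suc 2" using V by (simp add: numeral_3_eq_3 numeral_2_eq_2)
  have "card K < card V" using q_gt_1 K(3) V(2) by (simp add: power_strict_increasing[of 1 3 q, simplified])
  then have ne: "V - K \<noteq> {}" using K(2) by auto
  define g where "g = (\<lambda>w. dev f 0 (vec.span (insert w K)))"
  have "Max (g ` (V - K)) \<in> g ` (V - K)" using ne by (intro Max_in) auto
  then obtain w where w: "w \<in> V - K" "Max (g ` (V - K)) = g w" by (rule imageE)
  have max: "g w' \<le> g w" if "w' \<in> V - K" for w'
    unfolding w(2)[symmetric] using that by (intro Max_ge) auto
  define L where "L = vec.span (insert w K)"
  note L = line[OF w(1), folded L_def]
  have KL: "K \<subseteq> L" unfolding L_def by (auto intro: vec.span_base)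
  obtain \<alpha> where \<alpha>: "dev f \<alpha> L \<le> (q - 1) * e"
    using line_dominated[OF f e V(1) V' _ wt L] by auto
  then have "\<alpha> = 0" using no that L by blast
  note \<alpha> = \<alpha>[unfolded this]
  \<comment> \<open>With a zero \<open>R\<close> on \<open>L\<close> as reference point, the
    \<open>s\<close> of \<open>line_point\<close> counts the support points of
    \<open>L\<close>.\<close>
  have "\<exists>R\<in>L - {0}. f R = 0"
  proof (rule ccontr)
    assume "\<not> ?thesis"
    then have none: "{v \<in> L - {0}. f v = 0} = {}" by auto
    have "dev f 0 L + 1 = q\<^sup>2"
      using dev_complement[OF L(1), of f 0] unfolding none L(3) by simp
    moreover have "(q - 1) * e \<le> (q - 1) * q"
    proof -
      have "e \<le> (e + 2)\<^sup>2" by (simp add: power2_eq_square)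
      then show ?thesis using e by (intro mult_le_mono2) linarith
    qed
    moreover have "(q - 1) * q + q = q\<^sup>2"
      using q_gt_1 by (cases q) (auto simp: power2_eq_square)
    ultimately show False using \<alpha> q_gt_1 by linarith
  qed
  then obtain R where R: "R \<in> L" "R \<noteq> 0" "f R = 0" by auto
  obtain s where s: "dev f (f R) L = (q - 1) * s" "s \<le> q"
    and plane: "\<And>C. C \<notin> L \<Longrightarrow> (q - 1) * (s * (q - s)) \<le> card {v \<in> vec.span (insert C L) - L. f v \<noteq> 0}"
    using line_point[OF f L(1,3) R(1,2)] by blast
  note s = s[unfolded R(3)]
  have "s \<le> e" using \<alpha> s(1) q_gt_1 by simp
  have "card L < card V" unfolding L(3) V(2) using q_gt_1 by (intro power_strict_increasing) auto
  then obtain C where C: "C \<in> V" "C \<notin> L" by (rule card_less_obtain[OF finite])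
  have "vec.span (insert C L) = V"
  proof (rule card_subset_eq)
    show "vec.span (insert C L) \<subseteq> V" using C L V by (intro vec.span_minimal) auto
    show "card (vec.span (insert C L)) = card V"
      using card_span_insert[OF L(1) C(2)] by (simp add: card_F L(3) V(2) power2_eq_square power3_eq_cube)
  qed simp
  then have lower: "(q - 1) * (s * (q - s)) \<le> card {v \<in> V - L. f v \<noteq> 0}"
    using plane[OF C(2)] by simp
  have "{v \<in> K - {0}. f v \<noteq> 0} = K - {0}"
    unfolding K_def vec.span_singleton using v\<^sub>0 hyp_comb_scale[OF f] by auto
  then have cardK: "card {v \<in> K - {0}. f v \<noteq> 0} = q - 1"
    using K by (simp add: card_Diff_singleton vec.subspace_0)
  \<comment> \<open>The summand \<open>q - 1\<close> stands for the nonzero multiples of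
    \<open>v\<^sub>0\<close>, which are common to all these lines; maximality of \<open>L\<close>
    bounds the total.\<close>
  have upper: "card {v \<in> vec.span (insert w' K) - K. f v \<noteq> 0} + (q - 1) \<le> (q - 1) * s"
    if "w' \<in> V - L" for w'
  proof -
    have "card {v \<in> vec.span (insert w' K) - K. f v \<noteq> 0} + (q - 1)
      = card ({v \<in> vec.span (insert w' K) - K. f v \<noteq> 0} \<union> {v \<in> K - {0}. f v \<noteq> 0})"
      unfolding cardK[symmetric] by (subst card_Un_disjoint) auto
    also have "{v \<in> vec.span (insert w' K) - K. f v \<noteq> 0} \<union> {v \<in> K - {0}. f v \<noteq> 0}
      \<subseteq> {v \<in> vec.span (insert w' K) - {0}. f v \<noteq> 0}"
      using vec.subspace_0[OF K(1)] by (auto intro: vec.span_base)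
    then have "card ({v \<in> vec.span (insert w' K) - K. f v \<noteq> 0} \<union> {v \<in> K - {0}. f v \<noteq> 0}) \<le> g w'"
      unfolding g_def dev_def by (rule card_mono[OF finite])
    also have "g w' \<le> g w" using that KL by (intro max) auto
    also have "g w = (q - 1) * s" using s(1) by (simp add: g_def L_def)
    finally show ?thesis .
  qed
  have "1 \<le> s"
    using upper[of C] C q_gt_1 by (cases s) auto
  have "(q - 1) * q * card {v \<in> V - L. f v \<noteq> 0}
    = (\<Sum>w\<in>V - L. card {v \<in> vec.span (insert w K) - K. f v \<noteq> 0})"
    using sum_card_span_insert[OF K(1) L(1) KL V(1) L(2), of "\<lambda>v. f v \<noteq> 0"] by (simp add: card_F K)
  also have "\<dots> \<le> (\<Sum>w\<in>V - L. (q - 1) * (s - 1))"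
    using upper by (intro sum_mono) (fastforce simp: diff_mult_distrib2)
  also have "\<dots> = (q - 1) * q * (q * ((q - 1) * (s - 1)))"
    using L(2) by (simp add: card_Diff_subset L(3) V(2) power2_eq_square power3_eq_cube algebra_simps)
  finally have "card {v \<in> V - L. f v \<noteq> 0} \<le> q * ((q - 1) * (s - 1))"
    using q_gt_1 by simp
  with lower have "(q - 1) * (s * (q - s)) \<le> q * ((q - 1) * (s - 1))"
    by (rule order.trans)
  also have "\<dots> = (q - 1) * (q * (s - 1))" by (simp only: mult_ac)
  finally have *: "s * (q - s) \<le> q * (s - 1)"
    by (rule nat_mult_le_cancel1[THEN iffD1, rotated]) (use q_gt_1 in simp)
  have "q + q * (s - 1) = q * s" using \<open>1 \<le> s\<close> by (cases s) auto
  moreover have "s * (q - s) + s * s = q * s"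
    using \<open>s \<le> q\<close> by (metis add_mult_distrib2 le_add_diff_inverse2 mult.commute)
  ultimately have "q \<le> s * s" using * by linarith
  also have "s * s \<le> e * e" using \<open>s \<le> e\<close> by (intro mult_le_mono)
  also have "e * e < (e + 2)\<^sup>2" by (simp add: power2_eq_square)
  finally show False using e by simp
qed

lemma dev_pairs_bound:
  assumes L: "vec.subspace (L :: ('f ^ 'm::finite) set)" "card L = q\<^sup>2" and dom: "dev f \<alpha> L \<le> c"
  shows "card {z \<in> (L - {0}) \<times> (L - {0}). f (fst z) \<noteq> f (snd z)} \<le> 2 * (c * (q\<^sup>2 - 1))"
proof -
  define A where "A = {v \<in> L - {0}. f v \<noteq> \<alpha>}"
  have card_L: "card (L - {0}) = q\<^sup>2 - 1"
    using vec.subspace_0[OF L(1)] by (simp add: card_Diff_singleton L(2))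
  have "{z \<in> (L - {0}) \<times> (L - {0}). f (fst z) \<noteq> f (snd z)} \<subseteq> A \<times> (L - {0}) \<union> (L - {0}) \<times> A"
    by (auto simp: A_def)
  then have "card {z \<in> (L - {0}) \<times> (L - {0}). f (fst z) \<noteq> f (snd z)}
      \<le> card (A \<times> (L - {0}) \<union> (L - {0}) \<times> A)"
    by (rule card_mono[OF finite])
  also have "\<dots> \<le> card (A \<times> (L - {0})) + card ((L - {0}) \<times> A)"
    by (rule card_Un_le)
  also have "\<dots> = 2 * (card A * (q\<^sup>2 - 1))"
    unfolding card_cartesian_product card_L by simp
  also have "\<dots> \<le> 2 * (c * (q\<^sup>2 - 1))"
    using dom by (intro mult_le_mono le_refl) (simp add: A_def dev_def)
  finally show ?thesis .
qed

lemma card_span_pair: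
  assumes "(u :: 'f ^ 'm::finite) \<noteq> 0" "v \<notin> vec.span {u}"
  shows "card (vec.span {v, u}) = q\<^sup>2"
  using card_span_insert[OF vec.subspace_span assms(2)] assms(1)
  by (simp add: span_insert_span card_span_singleton card_F power2_eq_square)

text \<open>Double counting of ordered pairs of nonzero vectors of \<open>U\<close> on which
  \<open>f\<close> differs. Such a pair lies in exactly one line, and there at least one of the two
  vectors deviates from the dominating value, whence the factor 2. So the average of
  \<open>dev f (f u) U\<close> over \<open>u\<close> meets the bound, and some \<open>f u\<close>
  serves as \<open>\<alpha>\<close>.\<close>

lemma subspace_dominated:
  fixes f :: "'f ^ 'm::finite \<Rightarrow> 'k"
  assumes f: "f \<in> hyp_comb" and e: "(e + 2)\<^sup>2 \<le> q"
    and V: "vec.subspace V" "card V = q ^ Suc d" "2 \<le> d" and wt: "dev f 0 V \<le> e * (q ^ d - 1)"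
    and U: "vec.subspace U" "U \<subseteq> V" "card U = q ^ Suc m"
  obtains \<alpha> where "dev f \<alpha> U \<le> 2 * e * (q ^ m - 1)"
proof (rule ccontr)
  assume "\<not> thesis"
  then have no: "2 * e * (q ^ m - 1) < dev f \<alpha> U" for \<alpha> using that by (meson not_le)
  \<comment> \<open>Lines are indexed by their ordered bases: \<open>I L\<close> collects the
    independent ordered pairs in \<open>L\<close>, so each line is counted
    \<open>(q\<^sup>2 - 1) * (q\<^sup>2 - q)\<close> times.\<close>
  define I where "I = (\<lambda>L :: ('f ^ 'm) set. SIGMA u:L - {0}. L - vec.span {u})"
  define sp where "sp = (\<lambda>z :: ('f ^ 'm) \<times> ('f ^ 'm). vec.span {snd z, fst z})"
  define D where "D = {z \<in> (U - {0}) \<times> (U - {0}). f (fst z) \<noteq> f (snd z)}"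
  have I_iff: "y \<in> I L \<longleftrightarrow> fst y \<in> L \<and> fst y \<noteq> 0 \<and> snd y \<in> L \<and> snd y \<notin> vec.span {fst y}" for y L
    by (cases y) (auto simp: I_def)
  have cardU: "card (U - {0}) = q * q ^ m - 1"
    using vec.subspace_0[OF U(1)] by (simp add: card_Diff_singleton U(3))
  have line: "vec.subspace (sp z)" "sp z \<subseteq> U" "card (sp z) = q\<^sup>2" if "z \<in> I U" for z
    using that U(1) card_span_pair[of "fst z" "snd z"] by (simp_all add: sp_def I_iff vec.span_minimal)
  \<comment> \<open>Proportional nonzero vectors have the same value, so a pair with different
    values spans a line.\<close>
  have indep: "z \<in> I U" if "z \<in> D" for z
  proof -
    have "f v = f u" if "v \<in> vec.span {u}" "v \<noteq> 0" for u v
      using that hyp_comb_scale[OF f] by (auto simp: vec.span_singleton)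
    then show ?thesis using that unfolding D_def I_iff by auto
  qed
  have pairs: "{y \<in> I U. fst z \<in> sp y \<and> snd z \<in> sp y} = I (sp z)" if z: "z \<in> I U" for z
  proof (rule subset_antisym; rule subsetI)
    fix y assume y: "y \<in> {y \<in> I U. fst z \<in> sp y \<and> snd z \<in> sp y}"
    have "vec.span {snd z, fst z} = sp y"
      using y z line[of y] by (intro span_pair_eq) (simp_all add: I_iff card_F)
    then have "sp z = sp y" by (simp add: sp_def)
    moreover have "fst y \<in> sp y" "snd y \<in> sp y" by (simp_all add: sp_def vec.span_base)
    ultimately show "y \<in> I (sp z)" using y by (simp add: I_iff)
  next
    fix y assume y: "y \<in> I (sp z)"
    have "vec.span {snd y, fst y} = sp z"
      using y z line[of z] by (intro span_pair_eq) (simp_all add: I_iff card_F)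
    then have "sp y = sp z" by (simp add: sp_def)
    moreover have "fst z \<in> sp z" "snd z \<in> sp z" by (simp_all add: sp_def vec.span_base)
    moreover have "y \<in> I U" using y line(2)[OF z] unfolding I_iff by blast
    ultimately show "y \<in> {y \<in> I U. fst z \<in> sp y \<and> snd z \<in> sp y}" by simp
  qed
  have card_I: "card (I L) = (card L - 1) * (card L - q)" if "vec.subspace L" for L
    unfolding I_def using card_independent_pairs[OF that] by (simp add: card_F)
  have "(\<Sum>y\<in>I U. card {z \<in> D. fst z \<in> sp y \<and> snd z \<in> sp y}) = (\<Sum>z\<in>D. (q\<^sup>2 - 1) * (q\<^sup>2 - q))"
  proof (rule sum_multicount_gen)
    show "\<forall>z\<in>D. card {y \<in> I U. fst z \<in> sp y \<and> snd z \<in> sp y} = (q\<^sup>2 - 1) * (q\<^sup>2 - q)"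
    proof
      fix z assume "z \<in> D"
      then have z: "z \<in> I U" by (rule indep)
      show "card {y \<in> I U. fst z \<in> sp y \<and> snd z \<in> sp y} = (q\<^sup>2 - 1) * (q\<^sup>2 - q)"
        unfolding pairs[OF z] card_I[OF line(1)[OF z]] line(3)[OF z] ..
    qed
  qed auto
  then have "card D * ((q\<^sup>2 - 1) * (q\<^sup>2 - q)) = (\<Sum>y\<in>I U. card {z \<in> D. fst z \<in> sp y \<and> snd z \<in> sp y})"
    by simp
  also have "\<dots> \<le> (\<Sum>y\<in>I U. 2 * (((q - 1) * e) * (q\<^sup>2 - 1)))"
  proof (rule sum_mono)
    fix y assume y: "y \<in> I U"
    obtain \<alpha> where \<alpha>: "dev f \<alpha> (sp y) \<le> (q - 1) * e"
      using line_dominated[OF f e V wt line(1)[OF y] _ line(3)[OF y]] line(2)[OF y] U(2) by blast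
    have "card {z \<in> D. fst z \<in> sp y \<and> snd z \<in> sp y}
      \<le> card {z \<in> (sp y - {0}) \<times> (sp y - {0}). f (fst z) \<noteq> f (snd z)}"
      by (rule card_mono[OF finite]) (auto simp: D_def)
    also have "\<dots> \<le> 2 * (((q - 1) * e) * (q\<^sup>2 - 1))"
      by (rule dev_pairs_bound[OF line(1)[OF y] line(3)[OF y] \<alpha>])
    finally show "card {z \<in> D. fst z \<in> sp y \<and> snd z \<in> sp y} \<le> 2 * (((q - 1) * e) * (q\<^sup>2 - 1))" .
  qed
  also have "\<dots> = ((q\<^sup>2 - 1) * (q * (q - 1))) * ((q * q ^ m - 1) * (2 * e * (q ^ m - 1)))"
  proof -
    have "q * q ^ m - q = q * (q ^ m - 1)" by (simp add: diff_mult_distrib2)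
    then show ?thesis by (simp add: card_I[OF U(1)] U(3) mult_ac)
  qed
  also have "q * (q - 1) = q\<^sup>2 - q" by (simp add: power2_eq_square diff_mult_distrib2)
  finally have "((q\<^sup>2 - 1) * (q\<^sup>2 - q)) * card D
      \<le> ((q\<^sup>2 - 1) * (q\<^sup>2 - q)) * ((q * q ^ m - 1) * (2 * e * (q ^ m - 1)))"
    by (simp only: mult.commute[of "card D"])
  moreover have "0 < (q\<^sup>2 - 1) * (q\<^sup>2 - q)"
    using q_gt_1 less_1_mult[of q q] by (simp add: power2_eq_square)
  ultimately have "card D \<le> (q * q ^ m - 1) * (2 * e * (q ^ m - 1))"
    by (simp only: nat_mult_le_cancel1)
  moreover have "card D = (\<Sum>u\<in>U - {0}. dev f (f u) U)"
  proof -
    have "D = (SIGMA u:U - {0}. {v \<in> U - {0}. f v \<noteq> f u})"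
      by (auto simp: D_def)
    then show ?thesis by (simp add: dev_def)
  qed
  moreover have "(\<Sum>u\<in>U - {0}. 2 * e * (q ^ m - 1)) < (\<Sum>u\<in>U - {0}. dev f (f u) U)"
  proof (rule sum_strict_mono)
    have "0 < q * q ^ m - 1" using one_less_power[OF q_gt_1, of "Suc m"] by simp
    then show "U - {0} \<noteq> {}" using cardU by (metis card.empty less_irrefl)
  qed (use no in auto)
  ultimately show False using cardU by simp
qed

section \<open>Splitting off hyperplanes\<close>

definition hyps :: "('f ^ 'm::finite) set \<Rightarrow> ('f ^ 'm) set set" where
  "hyps V = {G. vec.subspace G \<and> G \<subseteq> V \<and> q * card G = card V}"

definition decomp :: "('f ^ 'm::finite \<Rightarrow> 'k) \<Rightarrow> ('f ^ 'm) set \<Rightarrow> (('f ^ 'm) set \<Rightarrow> 'k) \<Rightarrow> bool" where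
  "decomp f V a \<longleftrightarrow> (\<forall>v\<in>V - {0}. f v = (\<Sum>G\<in>hyps V. if v \<in> G then a G else 0))"

definition components :: "('f ^ 'm::finite) set \<Rightarrow> (('f ^ 'm) set \<Rightarrow> 'k) \<Rightarrow> ('f ^ 'm) set set" where
  "components V a = {G \<in> hyps V. a G \<noteq> 0}"

lemma kernel_in_hyps:
  assumes "vec.subspace V" "v \<in> V" "dotp u v \<noteq> 0"
  shows "{v \<in> V. dotp u v = 0} \<in> hyps V"
  using subspace_kernel[OF assms(1), of u] card_kernel[OF assms] by (auto simp: hyps_def card_F)

lemma hyps_kernel:
  assumes "vec.subspace V" "G \<in> hyps V"
  obtains u v where "G = {v \<in> V. dotp u v = 0}" "v \<in> V" "dotp u v \<noteq> 0"
  using hyperplane_functional[OF assms(1), of G] assms(2) unfolding hyps_def card_F by blast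

lemma card_Int_hyps:
  assumes V: "vec.subspace V" and G: "G \<in> hyps V" and W: "vec.subspace W" "W \<subseteq> V" "\<not> W \<subseteq> G"
  shows "q * card (W \<inter> G) = card W"
proof -
  obtain u v where u: "G = {v \<in> V. dotp u v = 0}" by (rule hyps_kernel[OF V G])
  then obtain w where "w \<in> W" "dotp u w \<noteq> 0" using W by auto
  then have "q * card {v \<in> W. dotp u v = 0} = card W"
    using card_kernel[OF W(1)] by (simp add: card_F)
  moreover have "W \<inter> G = {v \<in> W. dotp u v = 0}" using u W by auto
  ultimately show ?thesis by simp
qed

lemma hyps_eqI:
  assumes "G \<in> hyps V" "G' \<in> hyps V" "G \<subseteq> G'"
  shows "G = G'"
proof (rule card_subset_eq[OF finite assms(3)])
  have "q * card G = q * card G'" using assms by (simp add: hyps_def)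
  then show "card G = card G'" using q_gt_1 by simp
qed

text \<open>Union bound; \<open>N\<close> is the size of a subspace of codimension one in
  \<open>W\<close>, and 0 is left out of each intersection.\<close>

lemma card_covered:
  assumes W: "vec.subspace (W :: ('f ^ 'm::finite) set)" "card W = q * N"
    and S: "\<And>G. G \<in> \<S> \<Longrightarrow> vec.subspace G \<and> q * card (W \<inter> G) = card W" and c: "card \<S> \<le> c"
  shows "card {v \<in> W - {0}. \<exists>G\<in>\<S>. v \<in> G} \<le> c * (N - 1)"
proof -
  have "{v \<in> W - {0}. \<exists>G\<in>\<S>. v \<in> G} = (\<Union>G\<in>\<S>. (W \<inter> G) - {0})" by auto
  moreover have "card (\<Union>G\<in>\<S>. (W \<inter> G) - {0}) \<le> (\<Sum>G\<in>\<S>. card ((W \<inter> G) - {0}))"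
    by (rule card_UN_le) simp
  moreover have "(\<Sum>G\<in>\<S>. card ((W \<inter> G) - {0})) = (\<Sum>G\<in>\<S>. N - 1)"
  proof (rule sum.cong[OF refl])
    fix G assume G: "G \<in> \<S>"
    have "0 \<in> W \<inter> G" using S[OF G] W by (auto simp: vec.subspace_0)
    moreover have "q * card (W \<inter> G) = q * N" using S[OF G] W by simp
    then have "card (W \<inter> G) = N" using q_gt_1 by simp
    ultimately show "card ((W \<inter> G) - {0}) = N - 1" by (simp add: card_Diff_singleton)
  qed
  moreover have "(\<Sum>G\<in>\<S>. N - 1) \<le> c * (N - 1)"
    unfolding sum_constant of_nat_id using c by (rule mult_le_mono1)
  ultimately show ?thesis by (simp only:)
qed

text \<open>Induction on the weight: subtract \<open>\<alpha>\<close> times a dominated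
  \<open>H\<close>. With \<open>D = dev f \<alpha> H\<close>, there are at least
  \<open>q ^ Suc k - 1 - D\<close> nonzero values on \<open>H\<close> before and \<open>D\<close>
  after. Since \<open>4 * D < q ^ Suc k - 1\<close>, each step lowers the weight by at least half of
  \<open>q ^ Suc k - 1\<close>, which bounds the number of components.\<close>

lemma decomp_of_heavy_hyperplane:
  fixes V :: "('f ^ 'm::finite) set"
  assumes V: "vec.subspace V" "card V = q ^ Suc (Suc k)" and e: "8 * e \<le> q"
    and heavy: "\<And>f :: 'f ^ 'm \<Rightarrow> 'k. f \<in> hyp_comb \<Longrightarrow> dev f 0 V \<le> e * (q ^ Suc k - 1)
      \<Longrightarrow> \<exists>v\<in>V - {0}. f v \<noteq> 0
      \<Longrightarrow> \<exists>H\<in>hyps V. \<exists>\<alpha>. \<alpha> \<noteq> 0 \<and> dev f \<alpha> H \<le> 2 * e * (q ^ k - 1)"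
    and f: "f \<in> hyp_comb" "dev f 0 V \<le> e * (q ^ Suc k - 1)"
  shows "\<exists>a. decomp f V a \<and> card (components V a) * (q ^ Suc k - 1) \<le> 2 * dev f 0 V"
  using f
proof (induction "dev f 0 V" arbitrary: f rule: less_induct)
  case less
  show ?case
  proof (cases "\<exists>v\<in>V - {0}. f v \<noteq> 0")
    case False
    then have "decomp f V (\<lambda>_. 0)" by (auto simp: decomp_def)
    moreover have "components V (\<lambda>_. 0) = {}" by (simp add: components_def)
    ultimately show ?thesis by (intro exI[of _ "\<lambda>_. 0"]) simp
  next
    case True
    then obtain H \<alpha> where H: "H \<in> hyps V" and \<alpha>: "\<alpha> \<noteq> 0" "dev f \<alpha> H \<le> 2 * e * (q ^ k - 1)"
      using heavy[OF less.prems] by blast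
    obtain u where u: "H = {v \<in> V. dotp u v = 0}" by (rule hyps_kernel[OF V(1) H])
    have H': "vec.subspace H" "H \<subseteq> V" "card H = q ^ Suc k"
      using H V q_gt_1 by (auto simp: hyps_def)
    define g where "g = (\<lambda>v. f v - (if dotp u v = 0 then \<alpha> else 0))"
    have g: "g \<in> hyp_comb" unfolding g_def by (rule hyp_comb_diff[OF less.prems(1)])
    have g_eq: "g v = f v - (if v \<in> H then \<alpha> else 0)" if "v \<in> V" for v
      using that by (simp add: g_def u)
    have split: "dev f' 0 V = card {v \<in> V - H. f' v \<noteq> 0} + dev f' 0 H" for f' :: "'f ^ 'm \<Rightarrow> 'k"
    proof -
      have eq: "{v \<in> V - {0}. f' v \<noteq> 0} = {v \<in> V - H. f' v \<noteq> 0} \<union> {v \<in> H - {0}. f' v \<noteq> 0}"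
        using H' vec.subspace_0[OF H'(1)] by auto
      show ?thesis unfolding dev_def eq by (rule card_Un_disjoint) auto
    qed
    have "{v \<in> V - H. g v \<noteq> 0} = {v \<in> V - H. f v \<noteq> 0}" using g_eq by auto
    moreover have "dev g 0 H = dev f \<alpha> H"
      unfolding dev_def using g_eq H' by (intro arg_cong[of _ _ card]) auto
    moreover have "q ^ Suc k - 1 \<le> dev f 0 H + dev f \<alpha> H"
    proof -
      have "card {v \<in> H - {0}. f v = 0} \<le> dev f \<alpha> H"
        unfolding dev_def using \<alpha> by (intro card_mono) auto
      then show ?thesis using dev_complement[OF H'(1), of f 0] H' by simp
    qed
    ultimately have le: "dev g 0 V + (q ^ Suc k - 1) \<le> dev f 0 V + 2 * dev f \<alpha> H"
      using split[of f] split[of g] by simp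
    have "4 * dev f \<alpha> H \<le> 8 * e * (q ^ k - 1)" using \<alpha>(2) by simp
    also have "\<dots> \<le> q * (q ^ k - 1)" using e by (rule mult_le_mono1)
    also have "\<dots> < q ^ Suc k - 1"
    proof -
      have "q \<le> q * q ^ k" using q_gt_1 by simp
      then show ?thesis using q_gt_1 unfolding diff_mult_distrib2 power_Suc by linarith
    qed
    finally have small: "4 * dev f \<alpha> H < q ^ Suc k - 1" .
    have drop: "2 * dev g 0 V + (q ^ Suc k - 1) \<le> 2 * dev f 0 V" using le small by linarith
    then have "dev g 0 V < dev f 0 V" using small by linarith
    then obtain a where a: "decomp g V a" "card (components V a) * (q ^ Suc k - 1) \<le> 2 * dev g 0 V"
      using less.hyps[of g] g less.prems(2) by fastforce
    \<comment> \<open>\<open>H\<close> may already have a coefficient in \<open>a\<close>, so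
      \<open>\<alpha>\<close> is added to it; at most one component is new.\<close>
    define b where "b = (\<lambda>G. a G + (if G = H then \<alpha> else 0))"
    have "decomp f V b"
      unfolding decomp_def
    proof
      fix v assume v: "v \<in> V - {0}"
      have "(\<Sum>G\<in>hyps V. if v \<in> G then b G else 0)
        = (\<Sum>G\<in>hyps V. (if v \<in> G then a G else 0) + (if G = H then (if v \<in> H then \<alpha> else 0) else 0))"
        by (intro sum.cong) (auto simp: b_def)
      also have "\<dots> = g v + (if v \<in> H then \<alpha> else 0)"
        using a(1) v H by (simp add: sum.distrib decomp_def)
      also have "\<dots> = f v" using g_eq[of v] v by simp
      finally show "f v = (\<Sum>G\<in>hyps V. if v \<in> G then b G else 0)" by simp
    qed
    moreover have "card (components V b) \<le> card (components V a) + 1"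
    proof -
      have "components V b \<subseteq> insert H (components V a)" by (auto simp: components_def b_def)
      then have "card (components V b) \<le> card (insert H (components V a))"
        by (rule card_mono[OF finite])
      also have "\<dots> \<le> card (components V a) + 1" by (simp add: card_insert_if)
      finally show ?thesis .
    qed
    then have "card (components V b) * (q ^ Suc k - 1) \<le> (card (components V a) + 1) * (q ^ Suc k - 1)"
      by (rule mult_le_mono1)
    then have "card (components V b) * (q ^ Suc k - 1) \<le> 2 * dev f 0 V"
      using a(2) drop by (simp only: add_mult_distrib mult_1_left)
    ultimately show ?thesis by blast
  qed
qed

text \<open>Finds a hyperplane that contains no member of the two families. A nonzero vector of
  \<open>S\<close> restricts the functionals vanishing on \<open>S\<close> to a fraction
  \<open>1 / q\<close>, two independent vectors to \<open>1 / q\<^sup>2\<close>; by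
  \<open>bound\<close> these fractions sum to less than 1.\<close>

lemma exists_functional_avoiding:
  fixes \<A> \<B> :: "('f ^ 'm::finite) set set"
  assumes A: "\<And>S. S \<in> \<A> \<Longrightarrow> vec.subspace S \<and> q \<le> card S"
    and B: "\<And>S. S \<in> \<B> \<Longrightarrow> vec.subspace S \<and> q\<^sup>2 \<le> card S"
    and bound: "card \<A> * q + card \<B> < q\<^sup>2"
  obtains u where "\<And>S. S \<in> \<A> \<union> \<B> \<Longrightarrow> \<exists>v\<in>S. dotp u v \<noteq> 0"
proof (rule ccontr)
  assume no: "\<not> thesis"
  define T where "T = CARD('f ^ 'm)"
  define ann where "ann = (\<lambda>S :: ('f ^ 'm) set. {u. \<forall>v\<in>S. dotp u v = 0})"
  have 1: "q\<^sup>2 * card (ann S) \<le> q * T" if S: "S \<in> \<A>" for S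
  proof -
    have "card {0 :: 'f ^ 'm} < card S" using A[OF S] q_gt_1 by simp
    then obtain x where x: "x \<in> S" "x \<noteq> 0" using card_less_obtain[of "{0}" S] by blast
    obtain v where "dotp x v \<noteq> 0" using dotp_nonzero_exists[OF x(2)] by blast
    then have "q * card {u. dotp x u = 0} = T"
      using card_kernel[OF vec.subspace_UNIV, of v x] by (simp add: T_def card_F)
    moreover have "card (ann S) \<le> card {u. dotp x u = 0}"
      using x by (intro card_mono) (auto simp: ann_def dotp_commute)
    ultimately have "q * card (ann S) \<le> T" by (metis mult_le_mono2)
    then have "q * (q * card (ann S)) \<le> q * T" by (rule mult_le_mono2)
    then show ?thesis by (simp only: power2_eq_square mult.assoc)
  qed
  have 2: "q\<^sup>2 * card (ann S) \<le> T" if S: "S \<in> \<B>" for S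
  proof -
    have "q < q\<^sup>2" using q_gt_1 by (simp add: power2_eq_square)
    then have "card {0 :: 'f ^ 'm} < card S" using B[OF S] q_gt_1 by simp
    then obtain x where x: "x \<in> S" "x \<noteq> 0" using card_less_obtain[of "{0}" S] by blast
    have "card (vec.span {x}) < card S"
      using B[OF S] \<open>q < q\<^sup>2\<close> by (simp add: card_span_singleton[OF x(2)] card_F)
    then obtain y where y: "y \<in> S" "y \<notin> vec.span {x}" by (rule card_less_obtain[OF finite])
    obtain v where "dotp x v \<noteq> 0" using dotp_nonzero_exists[OF x(2)] by blast
    then have "q * card {u. dotp x u = 0} = T"
      using card_kernel[OF vec.subspace_UNIV, of v x] by (simp add: T_def card_F)
    \<comment> \<open>\<open>w\<close> is orthogonal to \<open>x\<close> but not to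
      \<open>y\<close>, so the condition from \<open>y\<close> is proper on the kernel of
      \<open>x\<close>.\<close>
    moreover obtain w where w: "\<forall>v\<in>vec.span {x}. dotp w v = 0" "dotp w y = 1"
      using separating_functional[OF vec.subspace_span y(2)] by blast
    have "dotp w x = 0" using w by (simp add: vec.span_base)
    then have "q * card {u \<in> {u. dotp x u = 0}. dotp y u = 0} = card {u. dotp x u = 0}"
      using card_kernel[OF subspace_kernel[OF vec.subspace_UNIV, of x], of w y] w
      by (simp add: card_F dotp_commute)
    moreover have "card (ann S) \<le> card {u \<in> {u. dotp x u = 0}. dotp y u = 0}"
      using x y by (intro card_mono) (auto simp: ann_def dotp_commute)
    then have "q * (q * card (ann S)) \<le> q * (q * card {u \<in> {u. dotp x u = 0}. dotp y u = 0})"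
      by (intro mult_le_mono2)
    ultimately show ?thesis by (simp only: power2_eq_square mult.assoc)
  qed
  have "u \<in> (\<Union>S\<in>\<A>. ann S) \<union> (\<Union>S\<in>\<B>. ann S)" for u
  proof (rule ccontr)
    assume "u \<notin> (\<Union>S\<in>\<A>. ann S) \<union> (\<Union>S\<in>\<B>. ann S)"
    then have "\<exists>v\<in>S. dotp u v \<noteq> 0" if "S \<in> \<A> \<union> \<B>" for S
      using that by (auto simp: ann_def)
    then show False using no that by blast
  qed
  then have "(\<Union>S\<in>\<A>. ann S) \<union> (\<Union>S\<in>\<B>. ann S) = UNIV" by blast
  then have "T \<le> card (\<Union>S\<in>\<A>. ann S) + card (\<Union>S\<in>\<B>. ann S)"
    unfolding T_def using card_Un_le[of "\<Union>S\<in>\<A>. ann S" "\<Union>S\<in>\<B>. ann S"] by simp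
  also have "\<dots> \<le> (\<Sum>S\<in>\<A>. card (ann S)) + (\<Sum>S\<in>\<B>. card (ann S))"
    by (intro add_mono card_UN_le) auto
  finally have "q\<^sup>2 * T \<le> q\<^sup>2 * ((\<Sum>S\<in>\<A>. card (ann S)) + (\<Sum>S\<in>\<B>. card (ann S)))"
    by (rule mult_le_mono2)
  also have "\<dots> = (\<Sum>S\<in>\<A>. q\<^sup>2 * card (ann S)) + (\<Sum>S\<in>\<B>. q\<^sup>2 * card (ann S))"
    by (simp add: distrib_left sum_distrib_left)
  also have "\<dots> \<le> (\<Sum>S\<in>\<A>. q * T) + (\<Sum>S\<in>\<B>. T)"
    by (intro add_mono sum_mono 1 2)
  also have "\<dots> = (card \<A> * q + card \<B>) * T" by (simp add: algebra_simps)
  finally have "q\<^sup>2 * T \<le> (card \<A> * q + card \<B>) * T" .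
  moreover have "0 < T" by (simp add: T_def)
  ultimately show False using bound by simp
qed

text \<open>The sets \<open>H - G\<close> are disjoint, because two distinct \<open>H\<close> meet
  exactly in \<open>G\<close>, and each has \<open>(q - 1) * card G\<close> of the
  \<open>(q\<^sup>2 - 1) * card G\<close> elements of \<open>V - G\<close>.\<close>

lemma card_hyps_through:
  fixes V G :: "('f ^ 'm::finite) set"
  assumes V: "vec.subspace V" and G: "vec.subspace G" "G \<subseteq> V" "q\<^sup>2 * card G = card V"
  shows "card {H \<in> hyps V. G \<subseteq> H} \<le> q + 1"
proof -
  let ?\<H> = "{H \<in> hyps V. G \<subseteq> H}"
  have G0: "0 < card G" using G(1) by (auto simp: card_gt_0_iff dest: vec.subspace_0)
  have cardH: "card H = q * card G" if "H \<in> ?\<H>" for H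
  proof -
    have "q * card H = q * (q * card G)" using that G(3) by (simp add: hyps_def power2_eq_square)
    then show ?thesis using q_gt_1 by simp
  qed
  have diff: "card (H - G) = (q - 1) * card G" if "H \<in> ?\<H>" for H
    using that cardH[OF that] by (simp add: card_Diff_subset diff_mult_distrib)
  have "card (\<Union>H\<in>?\<H>. H - G) = (\<Sum>H\<in>?\<H>. card (H - G))"
  proof (rule card_UN_disjoint)
    show "\<forall>H\<in>?\<H>. \<forall>H'\<in>?\<H>. H \<noteq> H' \<longrightarrow> (H - G) \<inter> (H' - G) = {}"
    proof (intro ballI impI)
      fix H H' assume H: "H \<in> ?\<H>" "H' \<in> ?\<H>" "H \<noteq> H'"
      then have "\<not> H \<subseteq> H'" using hyps_eqI by blast
      then have "q * card (H \<inter> H') = card H"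
        using H by (intro card_Int_hyps[OF V]) (auto simp: hyps_def)
      then have "card (H \<inter> H') = card G" using cardH[OF H(1)] q_gt_1 by simp
      then have "G = H \<inter> H'" using H by (intro card_subset_eq) auto
      then show "(H - G) \<inter> (H' - G) = {}" by blast
    qed
  qed auto
  also have "\<dots> = card ?\<H> * ((q - 1) * card G)" using diff by simp
  finally have "card ?\<H> * ((q - 1) * card G) = card (\<Union>H\<in>?\<H>. H - G)" by simp
  also have "\<dots> \<le> card (V - G)" by (intro card_mono) (auto simp: hyps_def)
  also have "\<dots> = (q + 1) * ((q - 1) * card G)"
  proof -
    have "(q + 1) * (q - 1) = q\<^sup>2 - 1"
      using q_gt_1 by (simp add: power2_eq_square algebra_simps)
    then have "(q + 1) * ((q - 1) * card G) = (q\<^sup>2 - 1) * card G" by (metis mult.assoc)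
    then show ?thesis using G by (simp add: card_Diff_subset diff_mult_distrib)
  qed
  finally have "((q - 1) * card G) * card ?\<H> \<le> ((q - 1) * card G) * (q + 1)"
    by (simp only: mult.commute)
  then show ?thesis
    by (rule nat_mult_le_cancel1[THEN iffD1, rotated]) (use q_gt_1 G0 in simp)
qed

section \<open>Recognising components from the values of the function\<close>

lemma heavy_count_arith:
  assumes "8 * e \<le> q" "1 \<le> M"
  shows "8 * e * (M - 1) < q * M - 1"
proof -
  have "8 * e * (M - 1) \<le> q * (M - 1)" using assms(1) by (rule mult_le_mono1)
  also have "\<dots> < q * M - 1"
  proof -
    have "q \<le> q * M" using assms(2) by simp
    then show ?thesis using q_gt_1 unfolding diff_mult_distrib2 by linarith
  qed
  finally show ?thesis .
qed

lemma components_value: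
  assumes "decomp f H a" "v \<in> H" "v \<noteq> 0"
  shows "f v = (\<Sum>G\<in>components H a. if v \<in> G then a G else 0)"
proof -
  have "f v = (\<Sum>G\<in>hyps H. if v \<in> G then a G else 0)"
    using assms by (simp add: decomp_def)
  also have "\<dots> = (\<Sum>G\<in>components H a. if v \<in> G then a G else 0)"
    by (rule sum.mono_neutral_right) (auto simp: components_def)
  finally show ?thesis .
qed

lemma components_value_unique:
  assumes "decomp f H a" "v \<in> H" "v \<noteq> 0" "G \<in> components H a" "v \<in> G"
    and "\<And>G'. G' \<in> components H a \<Longrightarrow> v \<in> G' \<Longrightarrow> G' = G"
  shows "f v = a G" "f v \<noteq> 0"
proof -
  have "f v = (\<Sum>G'\<in>components H a. if v \<in> G' then a G' else 0)"
    by (rule components_value[OF assms(1-3)])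
  also have "\<dots> = (\<Sum>G'\<in>{G}. if v \<in> G' then a G' else 0)"
  proof (rule sum.mono_neutral_right)
    show "\<forall>G'\<in>components H a - {G}. (if v \<in> G' then a G' else 0) = 0"
      using assms(6) by force
  qed (use assms(4) in simp_all)
  finally show "f v = a G" using assms(5) by simp
  then show "f v \<noteq> 0" using assms(4) by (simp add: components_def)
qed

lemma components_cover:
  assumes "decomp f H a" "v \<in> H" "v \<noteq> 0" "f v \<noteq> 0"
  shows "\<exists>G\<in>components H a. v \<in> G"
proof (rule ccontr)
  assume "\<not> ?thesis"
  then have "(\<Sum>G\<in>components H a. if v \<in> G then a G else 0) = 0"
    by (intro sum.neutral) auto
  then show False using components_value[OF assms(1-3)] assms(4) by simp
qed

text \<open>
  A component of \<open>f\<close> on some hyperplane is recognised by \<open>f\<close> alone: \<open>f\<close> is nonzero on more than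
  half of it. Hence it is a component on each hyperplane that contains it.
\<close>

lemma component_heavy:
  fixes H :: "('f ^ 'm::finite) set"
  assumes H: "vec.subspace H" "card H = q * (q * N)" and N: "1 \<le> N" and e: "8 * e \<le> q"
    and a: "decomp f H a" "card (components H a) \<le> 4 * e" and G: "G \<in> components H a"
  shows "q * N - 1 < 2 * dev f 0 G"
proof -
  let ?\<S> = "components H a - {G}"
  have Gh: "G \<in> hyps H" "vec.subspace G" "G \<subseteq> H"
    using G by (auto simp: components_def hyps_def)
  have cardG: "card G = q * N"
    using Gh(1) H(2) q_gt_1 by (simp add: hyps_def)
  have "card {v \<in> G - {0}. \<exists>G'\<in>?\<S>. v \<in> G'} \<le> 4 * e * (N - 1)"
  proof (rule card_covered[OF Gh(2) cardG])
    fix G' assume G': "G' \<in> ?\<S>"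
    then have "G' \<in> hyps H" "G \<noteq> G'" by (auto simp: components_def)
    moreover then have "\<not> G \<subseteq> G'" using Gh hyps_eqI by blast
    ultimately show "vec.subspace G' \<and> q * card (G \<inter> G') = card G"
      using card_Int_hyps[OF H(1), of G' G] Gh by (auto simp: hyps_def)
  next
    show "card ?\<S> \<le> 4 * e" using a(2) card_mono[OF finite, of ?\<S> "components H a"] by force
  qed
  moreover have "{v \<in> G - {0}. f v = 0} \<subseteq> {v \<in> G - {0}. \<exists>G'\<in>?\<S>. v \<in> G'}"
    using components_value_unique(2)[OF a(1) _ _ G] Gh(3) by blast
  then have "card {v \<in> G - {0}. f v = 0} \<le> card {v \<in> G - {0}. \<exists>G'\<in>?\<S>. v \<in> G'}"
    by (rule card_mono[OF finite])
  ultimately have "2 * card {v \<in> G - {0}. f v = 0} \<le> 8 * e * (N - 1)" by simp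
  then show ?thesis
    using heavy_count_arith[OF e N] dev_complement[OF Gh(2), of f 0] cardG by linarith
qed

text \<open>The support on \<open>G\<close> lies in the intersections with components. If
  \<open>G\<close> is not a component itself, at most \<open>4 * e\<close> proper intersections
  cover less than half of its nonzero vectors.\<close>

lemma heavy_component:
  fixes H :: "('f ^ 'm::finite) set"
  assumes H: "vec.subspace H" "card H = q * (q * N)" and N: "1 \<le> N" and e: "8 * e \<le> q"
    and a: "decomp f H a" "card (components H a) \<le> 4 * e"
    and G: "G \<in> hyps H" "q * N - 1 < 2 * dev f 0 G"
  shows "G \<in> components H a"
proof (rule ccontr)
  assume no: "G \<notin> components H a"
  have Gh: "vec.subspace G" "G \<subseteq> H" using G by (auto simp: hyps_def)
  have cardG: "card G = q * N" using G(1) H(2) q_gt_1 by (simp add: hyps_def)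
  have "card {v \<in> G - {0}. \<exists>G'\<in>components H a. v \<in> G'} \<le> 4 * e * (N - 1)"
  proof (rule card_covered[OF Gh(1) cardG])
    fix G' assume G': "G' \<in> components H a"
    then have "G' \<in> hyps H" "G \<noteq> G'" using no by (auto simp: components_def)
    moreover then have "\<not> G \<subseteq> G'" using G hyps_eqI by blast
    ultimately show "vec.subspace G' \<and> q * card (G \<inter> G') = card G"
      using card_Int_hyps[OF H(1), of G' G] Gh by (auto simp: hyps_def)
  qed (rule a(2))
  moreover have "dev f 0 G \<le> card {v \<in> G - {0}. \<exists>G'\<in>components H a. v \<in> G'}"
    unfolding dev_def using components_cover[OF a(1)] Gh by (intro card_mono) auto
  ultimately have "2 * dev f 0 G \<le> 8 * e * (N - 1)" by simp
  then show False using heavy_count_arith[OF e N] G(2) by simp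
qed

text \<open>When no hyperplane of \<open>V\<close> is dominated by a nonzero value, each is
  dominated by 0 and induction supplies \<open>dec\<close>. The components of the restrictions have
  codimension two in \<open>V\<close>; the form of \<open>card V\<close> says that the projective
  dimension is at least 3.\<close>

lemma no_heavy_hyperplane_contradiction:
  fixes V :: "('f ^ 'm::finite) set" and f :: "'f ^ 'm \<Rightarrow> 'k"
  assumes V: "vec.subspace V" "card V = q * (q * (q * (q * M)))" and M: "1 \<le> M"
    and e: "16 * e \<le> q" and q4: "4 \<le> q"
    and dec: "\<And>H. H \<in> hyps V \<Longrightarrow> \<exists>a. decomp f H a \<and> card (components H a) \<le> 4 * e"
    and v\<^sub>0: "v\<^sub>0 \<in> V" "v\<^sub>0 \<noteq> 0" "f v\<^sub>0 \<noteq> 0"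
  shows False
proof -
  define N where "N = q * M"
  have e8: "8 * e \<le> q" using e by simp
  have N: "1 \<le> N" unfolding N_def using M q_gt_1 by simp
  obtain a where dec: "\<And>H. H \<in> hyps V \<Longrightarrow> decomp f H (a H)"
    and comp: "\<And>H. H \<in> hyps V \<Longrightarrow> card (components H (a H)) \<le> 4 * e"
    using dec by metis
  define \<L> where "\<L> = (\<lambda>H. components H (a H))"
  have hyp: "vec.subspace H" "H \<subseteq> V" "card H = q * (q * N)" if "H \<in> hyps V" for H
    using that V q_gt_1 by (auto simp: hyps_def N_def)
  have comp_hyps: "G \<in> hyps H" if "G \<in> \<L> H" for G H
    using that by (simp add: \<L>_def components_def)
  have comp_sub: "vec.subspace G" "G \<subseteq> H" "card G = q * N" if "H \<in> hyps V" "G \<in> \<L> H" for G H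
    using comp_hyps[OF that(2)] hyp[OF that(1)] q_gt_1 by (auto simp: hyps_def)
  have heavy: "q * N - 1 < 2 * dev f 0 G" if "H \<in> hyps V" "G \<in> \<L> H" for G H
    using component_heavy[OF hyp(1,3)[OF that(1)] N e8 dec[OF that(1)] comp[OF that(1)]] that(2)
    by (simp add: \<L>_def)
  have comp_transfer: "G \<in> \<L> H'" if "H \<in> hyps V" "G \<in> \<L> H" "H' \<in> hyps V" "G \<subseteq> H'" for G H H'
  proof -
    have "G \<in> hyps H'"
      using comp_sub[OF that(1,2)] hyp[OF that(3)] that(4) by (simp add: hyps_def)
    then show ?thesis
      using heavy_component[OF hyp(1,3)[OF that(3)] N e8 dec[OF that(3)] comp[OF that(3)]]
        heavy[OF that(1,2)] by (simp add: \<L>_def)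
  qed

  have "card (vec.span {v\<^sub>0}) < card V"
  proof -
    have "1 \<le> q * N" using N q_gt_1 by simp
    then have "q * 1 \<le> q * (q * N)" by (rule mult_le_mono2)
    then have "1 < q * (q * N)" using q_gt_1 by linarith
    then have "q * 1 < q * (q * (q * N))" using q_gt_1 by (intro mult_less_mono2) auto
    then show ?thesis by (simp add: card_span_singleton[OF v\<^sub>0(2)] card_F V N_def)
  qed
  \<comment> \<open>\<open>C\<close> yields a functional that vanishes at \<open>v\<^sub>0\<close>
    but not on \<open>V\<close>. Its kernel \<open>H\<^sub>0\<close> contains a support point, so
    the restriction of \<open>f\<close> to it has a component.\<close>
  then obtain C where C: "C \<in> V" "C \<notin> vec.span {v\<^sub>0}" by (rule card_less_obtain[OF finite])
  obtain u\<^sub>0 where u\<^sub>0: "\<forall>w\<in>vec.span {v\<^sub>0}. dotp u\<^sub>0 w = 0" "dotp u\<^sub>0 C = 1"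
    using separating_functional[OF vec.subspace_span C(2)] by blast
  define H\<^sub>0 where "H\<^sub>0 = {v \<in> V. dotp u\<^sub>0 v = 0}"
  have H\<^sub>0: "H\<^sub>0 \<in> hyps V" "v\<^sub>0 \<in> H\<^sub>0"
    using kernel_in_hyps[OF V(1) C(1), of u\<^sub>0] u\<^sub>0 v\<^sub>0(1) by (simp_all add: H\<^sub>0_def vec.span_base)
  obtain G\<^sub>0 where G\<^sub>0: "G\<^sub>0 \<in> \<L> H\<^sub>0"
    using components_cover[OF dec[OF H\<^sub>0(1)] H\<^sub>0(2) v\<^sub>0(2,3)] by (auto simp: \<L>_def)
  note G\<^sub>0' = comp_sub[OF H\<^sub>0(1) G\<^sub>0]
  \<comment> \<open>A hyperplane \<open>H\<close> that contains no member of \<open>\<A>\<close> or \<open>\<B>\<close> gives the contradiction: \<open>f\<close> is mostly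
    nonzero on \<open>G\<^sub>0 \<inter> H\<close>, which therefore lies in a component \<open>G\<close> of \<open>f\<close> on \<open>H\<close>; but \<open>G\<^sub>0\<close> and \<open>G\<close> then
    span a hyperplane, so \<open>G \<in> \<B>\<close>.\<close>
  define \<S> where "\<S> = \<L> H\<^sub>0 - {G\<^sub>0}"
  define \<H> where "\<H> = {H \<in> hyps V. G\<^sub>0 \<subseteq> H}"
  define \<A> where "\<A> = insert G\<^sub>0 ((\<lambda>G. G\<^sub>0 \<inter> G) ` \<S>)"
  define \<B> where "\<B> = (\<Union>H\<in>\<H>. \<L> H - {G\<^sub>0})"

  have card_S: "card \<S> \<le> 4 * e"
    unfolding \<S>_def \<L>_def using card_Diff1_le comp[OF H\<^sub>0(1)] by (rule order.trans)
  have S: "vec.subspace G" "G \<in> hyps H\<^sub>0" "card (G\<^sub>0 \<inter> G) = N" if "G \<in> \<S>" for G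
  proof -
    have G: "G \<in> \<L> H\<^sub>0" "G\<^sub>0 \<noteq> G" using that by (auto simp: \<S>_def)
    show "vec.subspace G" "G \<in> hyps H\<^sub>0" using comp_sub[OF H\<^sub>0(1) G(1)] comp_hyps[OF G(1)] by auto
    have "\<not> G\<^sub>0 \<subseteq> G" using hyps_eqI[OF comp_hyps[OF G\<^sub>0] comp_hyps[OF G(1)]] G(2) by blast
    then have "q * card (G\<^sub>0 \<inter> G) = q * N"
      using card_Int_hyps[OF hyp(1)[OF H\<^sub>0(1)] comp_hyps[OF G(1)] G\<^sub>0'(1,2)] G\<^sub>0'(3) by simp
    then show "card (G\<^sub>0 \<inter> G) = N" using q_gt_1 by simp
  qed
  have card_A: "card \<A> \<le> 4 * e + 1"
  proof -
    have "card \<A> \<le> Suc (card ((\<lambda>G. G\<^sub>0 \<inter> G) ` \<S>))"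
      unfolding \<A>_def by (rule card_insert_le_m1[of "Suc _", simplified]) simp
    also have "card ((\<lambda>G. G\<^sub>0 \<inter> G) ` \<S>) \<le> card \<S>" by (rule card_image_le) simp
    finally show ?thesis using card_S by simp
  qed
  have card_B: "card \<B> \<le> (q + 1) * (4 * e)"
  proof -
    have "card \<B> \<le> (\<Sum>H\<in>\<H>. card (\<L> H - {G\<^sub>0}))"
      unfolding \<B>_def by (rule card_UN_le) simp
    also have "\<dots> \<le> (\<Sum>H\<in>\<H>. 4 * e)"
    proof (rule sum_mono)
      fix H assume "H \<in> \<H>"
      then have "card (\<L> H) \<le> 4 * e" using comp[of H] by (simp add: \<H>_def \<L>_def)
      then show "card (\<L> H - {G\<^sub>0}) \<le> 4 * e"
        using card_Diff1_le[of "\<L> H" G\<^sub>0] by (rule order.trans[rotated])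
    qed
    also have "\<dots> = card \<H> * (4 * e)" by simp
    also have "card \<H> \<le> q + 1"
      unfolding \<H>_def using G\<^sub>0' hyp(2)[OF H\<^sub>0(1)] V
      by (intro card_hyps_through) (auto simp: N_def power2_eq_square)
    finally show ?thesis by simp
  qed
  \<comment> \<open>With \<open>16 * e \<le> q\<close> the two contributions, about
    \<open>4 * e * q\<close> each, stay below \<open>q\<^sup>2\<close>.\<close>
  have bound: "card \<A> * q + card \<B> < q\<^sup>2"
  proof -
    have "card \<A> * q \<le> (4 * e + 1) * q" using card_A by (rule mult_le_mono1)
    then have "2 * (card \<A> * q + card \<B>) \<le> 16 * e * q + 2 * q + 8 * e"
      using card_B by (simp add: algebra_simps)
    also have "\<dots> \<le> q * q + 2 * q + q" using e8 mult_le_mono1[OF e, of q] by linarith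
    also have "\<dots> < 2 * (q * q)" using q4 mult_le_mono1[OF q4, of q] by linarith
    finally show ?thesis by (simp add: power2_eq_square)
  qed
  have sub_A: "vec.subspace S \<and> q \<le> card S" if SA: "S \<in> \<A>" for S
  proof (cases "S = G\<^sub>0")
    case True
    then show ?thesis using G\<^sub>0' N by simp
  next
    case False
    then obtain G where "G \<in> \<S>" "S = G\<^sub>0 \<inter> G" using SA unfolding \<A>_def by blast
    then show ?thesis using S G\<^sub>0'(1) M by (simp add: N_def vec.subspace_inter)
  qed
  have sub_B: "vec.subspace S \<and> q\<^sup>2 \<le> card S" if SB: "S \<in> \<B>" for S
  proof -
    obtain H where "H \<in> hyps V" "S \<in> \<L> H" using SB unfolding \<B>_def \<H>_def by blast
    from comp_sub[OF this] show ?thesis using M by (simp add: N_def power2_eq_square)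
  qed
  obtain u where u: "\<And>S. S \<in> \<A> \<union> \<B> \<Longrightarrow> \<exists>v\<in>S. dotp u v \<noteq> 0"
    using exists_functional_avoiding[OF sub_A sub_B bound] by blast

  define H where "H = {v \<in> V. dotp u v = 0}"
  define W where "W = {v \<in> G\<^sub>0. dotp u v = 0}"
  have G\<^sub>0V: "G\<^sub>0 \<subseteq> V" using G\<^sub>0'(2) hyp(2)[OF H\<^sub>0(1)] by blast
  obtain w where w: "w \<in> G\<^sub>0" "dotp u w \<noteq> 0" using u[of G\<^sub>0] by (auto simp: \<A>_def)
  have H: "H \<in> hyps V" unfolding H_def using w G\<^sub>0V by (intro kernel_in_hyps[OF V(1)]) auto
  have W: "vec.subspace W" "card W = q * M" "W \<subseteq> H" "W \<subseteq> G\<^sub>0"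
    using subspace_kernel[OF G\<^sub>0'(1), of u] card_kernel[OF G\<^sub>0'(1) w] G\<^sub>0'(3) G\<^sub>0V q_gt_1
    by (auto simp: W_def H_def card_F N_def)
  \<comment> \<open>\<open>H\<close> contains none of the intersections
    \<open>G\<^sub>0 \<inter> G\<close>, so the other components on \<open>H\<^sub>0\<close> meet
    \<open>W\<close> in codimension one and cover less than half of it.\<close>
  have zeros: "card {v \<in> W - {0}. f v = 0} \<le> 4 * e * (M - 1)"
  proof -
    have "{v \<in> W - {0}. f v = 0} \<subseteq> {v \<in> W - {0}. \<exists>G\<in>\<S>. v \<in> G}"
      using components_value_unique(2)[OF dec[OF H\<^sub>0(1)], of _ G\<^sub>0] G\<^sub>0 G\<^sub>0'(2) W(4)
      unfolding \<S>_def \<L>_def by blast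
    then have "card {v \<in> W - {0}. f v = 0} \<le> card {v \<in> W - {0}. \<exists>G\<in>\<S>. v \<in> G}"
      by (rule card_mono[OF finite])
    also have "\<dots> \<le> 4 * e * (M - 1)"
    proof (rule card_covered[OF W(1,2) _ card_S])
      fix G assume G: "G \<in> \<S>"
      have sub: "vec.subspace (G\<^sub>0 \<inter> G)" using G\<^sub>0'(1) S(1)[OF G] by (rule vec.subspace_inter)
      obtain x where x: "x \<in> G\<^sub>0 \<inter> G" "dotp u x \<noteq> 0" using u[of "G\<^sub>0 \<inter> G"] G by (auto simp: \<A>_def)
      have "q * card {v \<in> G\<^sub>0 \<inter> G. dotp u v = 0} = q * M"
        using card_kernel[OF sub x] S(3)[OF G] by (simp add: card_F N_def)
      moreover have "{v \<in> G\<^sub>0 \<inter> G. dotp u v = 0} = W \<inter> G" by (auto simp: W_def)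
      ultimately show "vec.subspace G \<and> q * card (W \<inter> G) = card W" using S(1)[OF G] W(2) by simp
    qed
    finally show ?thesis .
  qed
  \<comment> \<open>Otherwise the components on \<open>H\<close> also cover less than half of
    \<open>W\<close>, too little for the support of \<open>f\<close> on \<open>W\<close>.\<close>
  have "\<exists>G\<in>\<L> H. W \<subseteq> G"
  proof (rule ccontr)
    assume no: "\<not> ?thesis"
    have "dev f 0 W \<le> card {v \<in> W - {0}. \<exists>G\<in>\<L> H. v \<in> G}"
      unfolding dev_def \<L>_def using components_cover[OF dec[OF H]] W(3) by (intro card_mono) auto
    also have "\<dots> \<le> 4 * e * (M - 1)"
    proof (rule card_covered[OF W(1,2)])
      fix G assume G: "G \<in> \<L> H"
      then show "vec.subspace G \<and> q * card (W \<inter> G) = card W"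
        using comp_sub(1)[OF H G] card_Int_hyps[OF hyp(1)[OF H] comp_hyps[OF G] W(1,3)] no by blast
    next
      show "card (\<L> H) \<le> 4 * e" using comp[OF H] by (simp add: \<L>_def)
    qed
    finally have "card W - 1 \<le> 8 * e * (M - 1)"
      using zeros dev_complement[OF W(1), of f 0] by linarith
    then show False using heavy_count_arith[OF e8 M] W(2) by simp
  qed
  then obtain G where G: "G \<in> \<L> H" "W \<subseteq> G" by blast
  note G' = comp_sub[OF H G(1)]
  have "\<not> G \<subseteq> G\<^sub>0"
  proof
    assume "G \<subseteq> G\<^sub>0"
    then have "G = G\<^sub>0" using G'(3) G\<^sub>0'(3) by (intro card_subset_eq) auto
    then show False using w G'(2) by (auto simp: H_def)
  qed
  then obtain y where y: "y \<in> G" "y \<notin> G\<^sub>0" by blast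
  \<comment> \<open>\<open>G\<close> is spanned by \<open>W\<close> and \<open>y\<close>, so
    \<open>H'\<close> contains both \<open>G\<^sub>0\<close> and \<open>G\<close>. By
    \<open>comp_transfer\<close>, \<open>G\<close> is a component on \<open>H'\<close> and hence a
    member of \<open>\<B>\<close>, yet it lies in \<open>H\<close>.\<close>
  define H' where "H' = vec.span (insert y G\<^sub>0)"
  have "H' \<subseteq> V"
    unfolding H'_def using y(1) G'(2) hyp(2)[OF H] G\<^sub>0V V(1) by (intro vec.span_minimal) auto
  then have H': "H' \<in> hyps V"
    using card_span_insert[OF G\<^sub>0'(1) y(2)] G\<^sub>0'(3) V(2)
    by (simp add: hyps_def H'_def card_F N_def vec.subspace_span)
  have "vec.span (insert y W) = G"
  proof (rule card_subset_eq[OF finite])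
    show "vec.span (insert y W) \<subseteq> G" using y(1) G(2) G'(1) by (intro vec.span_minimal) auto
    have "y \<notin> W" using y(2) W(4) by blast
    then show "card (vec.span (insert y W)) = card G"
      using card_span_insert[OF W(1)] W(2) G'(3) by (simp add: card_F N_def)
  qed
  then have "G \<subseteq> H'" unfolding H'_def using W(4) by (metis insert_mono vec.span_mono)
  then have "G \<in> \<L> H'" using comp_transfer[OF H G(1) H'] by blast
  moreover have "H' \<in> \<H>" using H' by (auto simp: \<H>_def H'_def vec.span_base)
  ultimately have "G \<in> \<B>" using y by (auto simp: \<B>_def)
  then obtain v where "v \<in> G" "dotp u v \<noteq> 0" using u by blast
  then show False using G'(2) by (auto simp: H_def)
qed

lemma components_card_le:
  fixes c x e :: nat
  assumes "c * (q ^ Suc k - 1) \<le> 2 * x" "x \<le> e * (q ^ Suc k - 1)"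
  shows "c \<le> 2 * e"
proof -
  have "c * (q ^ Suc k - 1) \<le> 2 * (e * (q ^ Suc k - 1))"
    using assms by linarith
  then have "(q ^ Suc k - 1) * c \<le> (q ^ Suc k - 1) * (2 * e)"
    by (simp only: mult_ac)
  then show ?thesis
    by (rule nat_mult_le_cancel1[THEN iffD1, rotated]) (use one_less_power[OF q_gt_1, of "Suc k"] in simp)
qed

text \<open>Induction on the projective dimension \<open>k + 2\<close>, starting with planes.
  Passing to a hyperplane dominated by 0 doubles \<open>e\<close>, which accounts for the factor
  \<open>2 ^ k\<close>.\<close>

lemma hyperplane_decomposition:
  fixes V :: "('f ^ 'm::finite) set" and f :: "'f ^ 'm \<Rightarrow> 'k"
  assumes "vec.subspace V" "card V = q ^ (k + 3)" "f \<in> hyp_comb"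
    and "(2 ^ k * e + 2)\<^sup>2 \<le> q" "dev f 0 V \<le> e * (q ^ (k + 2) - 1)"
  shows "\<exists>a. decomp f V a \<and> card (components V a) \<le> 2 * e"
  using assms
proof (induction k arbitrary: V f e)
  case (0 V f e)
  have e2: "(e + 2)\<^sup>2 \<le> q" using "0.prems"(4) by simp
  have e8: "8 * e \<le> q"
  proof -
    \<comment> \<open>The square is the difference of \<open>(e + 2)\<^sup>2\<close> and
      \<open>8 * e\<close>.\<close>
    have "0 \<le> (int e - 2)\<^sup>2" by simp
    then have "int (8 * e) \<le> int ((e + 2)\<^sup>2)" by (simp add: power2_eq_square algebra_simps)
    then show ?thesis using e2 by linarith
  qed
  have V: "card V = q ^ Suc (Suc 1)" "card V = q ^ 3" using "0.prems"(2) by (simp_all add: numeral_3_eq_3)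
  have "\<exists>a. decomp f V a \<and> card (components V a) * (q ^ Suc 1 - 1) \<le> 2 * dev f 0 V"
  proof (rule decomp_of_heavy_hyperplane[OF "0.prems"(1) V(1) e8])
    fix g :: "'f ^ 'm \<Rightarrow> 'k"
    assume g: "g \<in> hyp_comb" "dev g 0 V \<le> e * (q ^ Suc 1 - 1)" "\<exists>v\<in>V - {0}. g v \<noteq> 0"
    then obtain v where v: "v \<in> V" "v \<noteq> 0" "g v \<noteq> 0" by blast
    have "dev g 0 V \<le> e * (q\<^sup>2 - 1)" using g(2) by (simp add: power2_eq_square)
    then obtain L \<alpha> where L: "vec.subspace L" "L \<subseteq> V" "card L = q\<^sup>2" "\<alpha> \<noteq> 0" "dev g \<alpha> L \<le> (q - 1) * e"
      using plane_heavy_line[OF g(1) e2 "0.prems"(1) V(2) _ v] by blast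
    have "L \<in> hyps V" using L V(2) by (simp add: hyps_def power2_eq_square power3_eq_cube)
    moreover have "2 * e * (q ^ 1 - 1) = 2 * ((q - 1) * e)" by simp
    then have "dev g \<alpha> L \<le> 2 * e * (q ^ 1 - 1)" using L(5) by linarith
    ultimately show "\<exists>H\<in>hyps V. \<exists>\<alpha>. \<alpha> \<noteq> 0 \<and> dev g \<alpha> H \<le> 2 * e * (q ^ 1 - 1)" using L(4) by blast
  qed (use "0.prems" in \<open>simp_all add: numeral_2_eq_2\<close>)
  then obtain a where a: "decomp f V a" "card (components V a) * (q ^ Suc 1 - 1) \<le> 2 * dev f 0 V" by blast
  have "dev f 0 V \<le> e * (q ^ Suc 1 - 1)" using "0.prems"(5) by (simp add: numeral_2_eq_2)
  then have "card (components V a) \<le> 2 * e" by (rule components_card_le[OF a(2)])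
  with a(1) show ?case by blast
next
  case (Suc k V f e)
  have cond: "(2 ^ k * (2 * e) + 2)\<^sup>2 \<le> q" using Suc.prems(4) by (simp add: mult_ac)
  have ee: "e \<le> 2 ^ k * e" by simp
  have e2: "(2 * e + 2)\<^sup>2 \<le> q"
  proof -
    have "2 * e + 2 \<le> 2 ^ k * (2 * e) + 2" using ee by simp
    then have "(2 * e + 2)\<^sup>2 \<le> (2 ^ k * (2 * e) + 2)\<^sup>2" by (rule power_mono) simp
    then show ?thesis using cond by (rule order.trans)
  qed
  have "(e + 2)\<^sup>2 \<le> (2 * e + 2)\<^sup>2" by (rule power_mono) simp_all
  then have e1: "(e + 2)\<^sup>2 \<le> q" using e2 by (rule order.trans)
  have q4: "4 \<le> q" using power_mono[of 2 "2 * e + 2" 2] e2 by simp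
  have e16: "16 * e \<le> q"
  proof -
    have "0 \<le> (2 * int e - 2)\<^sup>2" by simp
    then have "int (16 * e) \<le> int ((2 * e + 2)\<^sup>2)" by (simp add: power2_eq_square algebra_simps)
    then show ?thesis using e2 by linarith
  qed
  have V: "card V = q ^ Suc (Suc (k + 2))" "card V = q ^ Suc (k + 3)"
    using Suc.prems(2) by (simp_all add: eval_nat_numeral)
  have "\<exists>a. decomp f V a \<and> card (components V a) * (q ^ Suc (k + 2) - 1) \<le> 2 * dev f 0 V"
  proof (rule decomp_of_heavy_hyperplane[OF Suc.prems(1) V(1)])
    show "8 * e \<le> q" using e16 by simp
    fix g :: "'f ^ 'm \<Rightarrow> 'k"
    assume g: "g \<in> hyp_comb" "dev g 0 V \<le> e * (q ^ Suc (k + 2) - 1)" "\<exists>v\<in>V - {0}. g v \<noteq> 0"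
    then obtain v where v: "v \<in> V" "v \<noteq> 0" "g v \<noteq> 0" by blast
    show "\<exists>H\<in>hyps V. \<exists>\<alpha>. \<alpha> \<noteq> 0 \<and> dev g \<alpha> H \<le> 2 * e * (q ^ (k + 2) - 1)"
    proof (rule ccontr)
      assume no: "\<not> ?thesis"
      have "\<exists>a. decomp g H a \<and> card (components H a) \<le> 4 * e" if H: "H \<in> hyps V" for H
      proof -
        have H': "vec.subspace H" "H \<subseteq> V" "card H = q ^ Suc (k + 2)"
          using H V q_gt_1 by (auto simp: hyps_def)
        have wt: "dev g 0 V \<le> e * (q ^ (k + 3) - 1)"
          using g(2) by (simp add: eval_nat_numeral)
        obtain \<alpha> where \<alpha>: "dev g \<alpha> H \<le> 2 * e * (q ^ (k + 2) - 1)"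
          using subspace_dominated[OF g(1) e1 Suc.prems(1) V(2) _ wt H'] by auto
        \<comment> \<open>A nonzero \<open>\<alpha>\<close> would contradict \<open>no\<close>. With
          \<open>\<alpha> = 0\<close> the bound on \<open>H\<close> is the weight bound of the
          induction hypothesis with \<open>2 * e\<close> in place of \<open>e\<close>.\<close>
        then have "\<alpha> = 0" using no H by blast
        then have "\<exists>a. decomp g H a \<and> card (components H a) \<le> 2 * (2 * e)"
          using \<alpha> H' by (intro Suc.IH[OF _ _ g(1) cond]) (simp_all add: eval_nat_numeral)
        then show ?thesis by simp
      qed
      moreover have "card V = q * (q * (q * (q * q ^ k)))"
        unfolding V(1) by simp
      moreover have "1 \<le> q ^ k" using q_gt_1 by simp
      ultimately show False
        using no_heavy_hyperplane_contradiction[where V = V and M = "q ^ k" and e = e and f = g and v\<^sub>0 = v]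
          Suc.prems(1) e16 q4 v by blast
    qed
  qed (use Suc.prems in \<open>simp_all add: eval_nat_numeral\<close>)
  then obtain a where a: "decomp f V a" "card (components V a) * (q ^ Suc (k + 2) - 1) \<le> 2 * dev f 0 V" by blast
  have "dev f 0 V \<le> e * (q ^ Suc (k + 2) - 1)" using Suc.prems(5) by simp
  then have "card (components V a) \<le> 2 * e" by (rule components_card_le[OF a(2)])
  with a(1) show ?case by blast
qed

end

section \<open>Codewords\<close>

lemma hyp_comb_cong:
  assumes "f \<in> hyp_comb" "\<And>v. v \<noteq> 0 \<Longrightarrow> g v = f v"
  shows "g \<in> hyp_comb"
  using assms by (auto simp: hyp_comb_def)

lemma zero_in_hyp_comb: "(\<lambda>_. 0) \<in> hyp_comb"
  unfolding hyp_comb_def by (intro CollectI exI[of _ "\<lambda>_. 0"]) simp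

lemma sum_fun_apply: "(\<Sum>i\<in>I. f i) x = (\<Sum>i\<in>I. f i x)"
  by (induction I rule: infinite_finite_induct) auto

section \<open>Projective points and the vectors in them\<close>

lemma pg_point_span:
  fixes P :: "('f::{field,finite} ^ 'm::finite) set"
  assumes "P \<in> pg_points"
  shows "card P = CARD('f)" "v \<in> P \<Longrightarrow> v \<noteq> 0 \<Longrightarrow> vec.span {v} = P"
proof -
  have P: "vec.subspace P" and dim: "vec.dim P = 1" using assms by (auto simp: pg_points_def)
  show card: "card P = CARD('f)" using card_subspace[OF P] dim by simp
  assume v: "v \<in> P" "v \<noteq> 0"
  show "vec.span {v} = P"
  proof (rule card_subset_eq[OF finite])
    show "vec.span {v} \<subseteq> P" using v P by (intro vec.span_minimal) auto
    show "card (vec.span {v}) = card P" using card_span_singleton[OF v(2)] card by simp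
  qed
qed

lemma span_in_pg_points:
  fixes v :: "'f::{field,finite} ^ 'm::finite"
  assumes "v \<noteq> 0"
  shows "vec.span {v} \<in> pg_points"
proof -
  have "CARD('f) ^ vec.dim (vec.span {v}) = CARD('f) ^ 1"
    using card_subspace[OF vec.subspace_span, of "{v}"] card_span_singleton[OF assms] by simp
  then have "vec.dim (vec.span {v}) = 1"
    by (rule power_inject_exp[THEN iffD1, rotated]) (rule card_field_gt_1)
  then show ?thesis unfolding pg_points_def using vec.subspace_span by blast
qed

lemma char_fun_span:
  fixes H :: "('f::{field,finite} ^ 'm::finite) set"
  assumes "vec.subspace H" "v \<noteq> 0"
  shows "char_fun H (vec.span {v}) = (if v \<in> H then 1 else 0)"
proof -
  have "vec.span {v} \<subseteq> H \<longleftrightarrow> v \<in> H"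
    using vec.span_minimal[of "{v}" H] assms(1) by (auto intro: vec.span_base)
  then show ?thesis using span_in_pg_points[OF assms(2)] by (simp add: char_fun_def)
qed

context code_setting begin

lemma hyps_UNIV: "hyps UNIV = (pg_hyperplanes :: ('f ^ 'm::finite) set set)"
proof -
  have "q * card G = CARD('f ^ 'm) \<longleftrightarrow> vec.dim G + 1 = CARD('m)"
    if "vec.subspace G" for G :: "('f ^ 'm) set"
  proof -
    have "q * card G = q ^ (vec.dim G + 1)"
      using card_subspace[OF that] by (simp add: card_F)
    moreover have "CARD('f ^ 'm) = q ^ CARD('m)"
      using card_subspace[of "UNIV :: ('f ^ 'm) set"] by (simp add: card_F vec.dim_UNIV card_cart_basis)
    ultimately show ?thesis using q_gt_1 by (simp only: power_inject_exp)
  qed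
  then show ?thesis unfolding hyps_def pg_hyperplanes_def by auto
qed

lemma hyperplane_code_in_hyp_comb:
  fixes c :: "('f ^ 'm::finite) set \<Rightarrow> 'k"
  assumes "c \<in> hyperplane_code"
  shows "(\<lambda>v. c (vec.span {v})) \<in> hyp_comb" "P \<notin> pg_points \<Longrightarrow> c P = 0"
proof -
  have "(\<lambda>v. c (vec.span {v})) \<in> hyp_comb \<and> (\<forall>P. P \<notin> pg_points \<longrightarrow> c P = 0)"
    using assms unfolding hyperplane_code_def
  proof (induction rule: funspace.span_induct_alt)
    case base
    then show ?case by (simp add: zero_in_hyp_comb)
  next
    case (step b x y)
    then obtain H :: "('f ^ 'm) set" where H: "H \<in> hyps UNIV" and x: "x = char_fun H"
      unfolding hyps_UNIV by blast
    have sub: "vec.subspace H" using H by (simp add: hyps_def)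
    obtain u where u: "H = {v \<in> UNIV. dotp u v = 0}" by (rule hyps_kernel[OF vec.subspace_UNIV H])
    \<comment> \<open>Subtraction with coefficient \<open>- b\<close> adds the generator with
      coefficient \<open>b\<close>.\<close>
    have "(\<lambda>v. y (vec.span {v}) - (if dotp u v = 0 then - b else 0)) \<in> hyp_comb"
      using step by (intro hyp_comb_diff) simp
    moreover have "x (vec.span {v}) = (if dotp u v = 0 then 1 else 0)" if "v \<noteq> 0" for v
      unfolding x using char_fun_span[OF sub that] u by simp
    ultimately have "(\<lambda>v. (fun_scale b x + y) (vec.span {v})) \<in> hyp_comb"
      by (elim hyp_comb_cong) (simp add: fun_scale_def)
    moreover have "(fun_scale b x + y) P = 0" if "P \<notin> pg_points" for P
      using step that by (simp add: fun_scale_def x char_fun_def)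
    ultimately show ?case by blast
  qed
  then show "(\<lambda>v. c (vec.span {v})) \<in> hyp_comb" "P \<notin> pg_points \<Longrightarrow> c P = 0" by auto
qed

text \<open>The points of the support are disjoint apart from 0, and each has \<open>q - 1\<close>
  nonzero vectors.\<close>

lemma dev_eq_wt:
  fixes c :: "('f ^ 'm::finite) set \<Rightarrow> 'k"
  shows "dev (\<lambda>v. c (vec.span {v})) 0 UNIV = (q - 1) * wt c"
proof -
  have "{v \<in> UNIV - {0}. c (vec.span {v}) \<noteq> 0} = (\<Union>P\<in>supp c. P - {0})"
  proof (rule subset_antisym; rule subsetI)
    fix v assume "v \<in> {v \<in> UNIV - {0}. c (vec.span {v}) \<noteq> 0}"
    then have "v \<in> vec.span {v} - {0}" "vec.span {v} \<in> supp c"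
      using span_in_pg_points[of v] by (auto simp: supp_def vec.span_base)
    then show "v \<in> (\<Union>P\<in>supp c. P - {0})" by blast
  next
    fix v assume "v \<in> (\<Union>P\<in>supp c. P - {0})"
    then obtain P where P: "P \<in> pg_points" "c P \<noteq> 0" "v \<in> P" "v \<noteq> 0" by (auto simp: supp_def)
    then show "v \<in> {v \<in> UNIV - {0}. c (vec.span {v}) \<noteq> 0}" using pg_point_span(2)[OF P(1,3,4)] by simp
  qed
  then have "dev (\<lambda>v. c (vec.span {v})) 0 UNIV = card (\<Union>P\<in>supp c. P - {0})"
    by (simp only: dev_def)
  also have "\<dots> = (\<Sum>P\<in>supp c. card (P - {0}))"
  proof (rule card_UN_disjoint)
    show "\<forall>P\<in>supp c. \<forall>P'\<in>supp c. P \<noteq> P' \<longrightarrow> (P - {0}) \<inter> (P' - {0}) = {}"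
    proof (intro ballI impI)
      fix P P' assume PP: "P \<in> supp c" "P' \<in> supp c" "P \<noteq> P'"
      then have pts: "P \<in> pg_points" "P' \<in> pg_points" by (auto simp: supp_def)
      show "(P - {0}) \<inter> (P' - {0}) = {}"
        using pg_point_span(2)[OF pts(1)] pg_point_span(2)[OF pts(2)] PP(3) by blast
    qed
  qed auto
  also have "\<dots> = (\<Sum>P\<in>supp c. q - 1)"
  proof (rule sum.cong[OF refl])
    fix P assume "P \<in> supp c"
    then have P: "P \<in> pg_points" by (simp add: supp_def)
    then have "0 \<in> P" by (simp add: pg_points_def vec.subspace_0)
    then show "card (P - {0}) = q - 1" using pg_point_span(1)[OF P] by (simp add: card_Diff_singleton card_F)
  qed
  finally show ?thesis by (simp add: wt_def)
qed

text \<open>The upper bound is the union bound. For the lower one, vectors on exactly one component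
  belong to the support, and each of the \<open>m\<close> components loses at most
  \<open>(m - 1) * (N - 1)\<close> vectors to the others. The total loss is at most
  \<open>q * (N - 1)\<close>, less than one hyperplane, so the weight determines
  \<open>m\<close>.\<close>

lemma dev_decomp_bounds:
  fixes V :: "('f ^ 'm::finite) set"
  assumes V: "vec.subspace V" "card V = q * (q * N)" and N: "1 \<le> N" and a: "decomp f V a"
    and m: "m = card (components V a)" "m * (m - 1) \<le> q"
  shows "dev f 0 V \<le> m * (q * N - 1)" "m * (q * N - 1) < dev f 0 V + (q * N - 1)"
proof -
  let ?\<S> = "components V a"
  have hyp: "vec.subspace H" "H \<subseteq> V" "card H = q * N" if "H \<in> ?\<S>" for H
    using that V q_gt_1 by (auto simp: components_def hyps_def)
  have "dev f 0 V \<le> card (\<Union>H\<in>?\<S>. H - {0})"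
    unfolding dev_def using components_cover[OF a] by (intro card_mono) auto
  also have "\<dots> \<le> (\<Sum>H\<in>?\<S>. card (H - {0}))" by (rule card_UN_le) simp
  also have "\<dots> = (\<Sum>H\<in>?\<S>. q * N - 1)"
    using hyp by (intro sum.cong) (simp_all add: card_Diff_singleton vec.subspace_0)
  finally show "dev f 0 V \<le> m * (q * N - 1)" using m by simp
  define E where "E = (\<lambda>H. {v \<in> H - {0}. \<forall>G\<in>?\<S> - {H}. v \<notin> G})"
  have E: "q * N - 1 \<le> card (E H) + (m - 1) * (N - 1)" if H: "H \<in> ?\<S>" for H
  proof -
    have "card {v \<in> H - {0}. \<exists>G\<in>?\<S> - {H}. v \<in> G} \<le> (m - 1) * (N - 1)"
    proof (rule card_covered[OF hyp(1,3)[OF H]])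
      fix G assume G: "G \<in> ?\<S> - {H}"
      then have "G \<in> hyps V" "H \<in> hyps V" "H \<noteq> G" using H by (auto simp: components_def)
      moreover then have "\<not> H \<subseteq> G" using hyps_eqI by blast
      ultimately show "vec.subspace G \<and> q * card (H \<inter> G) = card H"
        using card_Int_hyps[OF V(1), of G H] by (auto simp: hyps_def)
    qed (use H m in \<open>simp add: card_Diff_singleton\<close>)
    moreover have eq: "H - {0} = E H \<union> {v \<in> H - {0}. \<exists>G\<in>?\<S> - {H}. v \<in> G}"
      by (auto simp: E_def)
    have "card (H - {0}) \<le> card (E H) + card {v \<in> H - {0}. \<exists>G\<in>?\<S> - {H}. v \<in> G}"
      by (rule ord_eq_le_trans[OF arg_cong[OF eq, of card] card_Un_le])
    moreover have "card (H - {0}) = q * N - 1"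
      using hyp[OF H] by (simp add: card_Diff_singleton vec.subspace_0)
    ultimately show ?thesis by linarith
  qed
  have "(\<Sum>H\<in>?\<S>. card (E H)) = card (\<Union>H\<in>?\<S>. E H)"
    by (rule card_UN_disjoint[symmetric]) (auto simp: E_def)
  also have "\<dots> \<le> dev f 0 V"
    unfolding dev_def
  proof (rule card_mono[OF finite], rule subsetI)
    fix v assume "v \<in> (\<Union>H\<in>?\<S>. E H)"
    then obtain H where H: "H \<in> ?\<S>" "v \<in> E H" by blast
    then have v: "v \<in> H" "v \<noteq> 0" "v \<in> V" using hyp(2)[OF H(1)] by (auto simp: E_def)
    have "f v \<noteq> 0"
      using H(2) by (intro components_value_unique(2)[OF a v(3,2) H(1) v(1)]) (auto simp: E_def)
    then show "v \<in> {v \<in> V - {0}. f v \<noteq> 0}" using v by simp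
  qed
  finally have "(\<Sum>H\<in>?\<S>. card (E H)) \<le> dev f 0 V" .
  moreover have "(\<Sum>H\<in>?\<S>. q * N - 1) \<le> (\<Sum>H\<in>?\<S>. card (E H) + (m - 1) * (N - 1))"
    by (intro sum_mono E)
  ultimately have "m * (q * N - 1) \<le> dev f 0 V + m * ((m - 1) * (N - 1))"
    by (simp add: sum.distrib m)
  also have "m * ((m - 1) * (N - 1)) = (m * (m - 1)) * (N - 1)" by (simp only: mult.assoc)
  also have "\<dots> \<le> q * (N - 1)" using m(2) by (rule mult_le_mono1)
  also have "q * (N - 1) < q * N - 1"
  proof -
    have "q \<le> q * N" using N by simp
    then show ?thesis using q_gt_1 unfolding diff_mult_distrib2 by linarith
  qed
  finally show "m * (q * N - 1) < dev f 0 V + (q * N - 1)" by simp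
qed

end

theorem theorem1p5:
  fixes n p h q :: nat
    and c :: "('f::{field,finite} ^ 'm::finite) set \<Rightarrow> 'k::{field,finite}"
  assumes "n \<ge> 3"
    and "prime p" and "h \<ge> 2" and "q = p ^ h" and "q > 27"
    and "CARD('f) = q" and "CARD('m) = n + 1" and "CARD('k) = p"
    and "c \<in> hyperplane_code"
    and "(h > 2 \<and> real (wt c) \<le>
            (of_int \<lfloor>1 / 2 ^ (n - 2) * sqrt (real q)\<rfloor> - 1) * theta q (int n - 1)) \<or>
         (h = 2 \<and> real (wt c) \<le>
            (of_int \<lfloor>real p / 2 ^ n\<rfloor> - 1) * theta q (int n - 1))"
  shows "\<exists>S a. S \<subseteq> (pg_hyperplanes :: ('f ^ 'm) set set) \<and>
           int (card S) = \<lceil>real (wt c) / theta q (int n - 1)\<rceil> \<and>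
           (\<forall>H\<in>S. a H \<noteq> 0) \<and>
           c = (\<Sum>H\<in>S. fun_scale (a H) (char_fun H))"
proof -
  interpret code_setting p h q "TYPE('f)" "TYPE('k)"
    by unfold_locales (use assms in auto)
  define \<theta> where "\<theta> = theta q (int n - 1)"
  have theta: "\<theta> = (real q ^ n - 1) / (real q - 1)"
    by (simp add: \<theta>_def theta_def)
  have qn: "1 < real q ^ n"
    using assms(1) q_gt_1 by (intro one_less_power) auto
  have \<theta>_pos: "0 < \<theta>"
    unfolding theta using qn q_gt_1 by simp
  \<comment> \<open>The case \<open>h = 2\<close> reduces to this bound because there
    \<open>p = sqrt q\<close> and \<open>p / 2 ^ n \<le> p / 2 ^ (n - 2)\<close>.\<close>
  define b where "b = \<lfloor>1 / 2 ^ (n - 2) * sqrt (real q)\<rfloor>"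
  have wt_le: "real (wt c) \<le> (of_int b - 1) * \<theta>"
    using assms(10)
  proof
    assume "h = 2 \<and> real (wt c) \<le> (of_int \<lfloor>real p / 2 ^ n\<rfloor> - 1) * theta q (int n - 1)"
    then have h: "h = 2" and le: "real (wt c) \<le> (of_int \<lfloor>real p / 2 ^ n\<rfloor> - 1) * \<theta>"
      by (auto simp: \<theta>_def)
    have "real p / 2 ^ n \<le> real p / 2 ^ (n - 2)"
      by (intro divide_left_mono power_increasing) auto
    also have "real p = sqrt (real q)"
      using h assms(4) by simp
    finally have "\<lfloor>real p / 2 ^ n\<rfloor> \<le> b"
      unfolding b_def using h assms(4) by (intro floor_mono) simp
    then have "(of_int \<lfloor>real p / 2 ^ n\<rfloor> - 1) * \<theta> \<le> (of_int b - 1) * \<theta>"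
      using \<theta>_pos by (intro mult_right_mono) auto
    with le show ?thesis by simp
  qed (simp add: b_def \<theta>_def)
  have "b \<ge> 1"
  proof (rule ccontr)
    assume "\<not> ?thesis"
    then have "(of_int b - 1) * \<theta> < 0"
      using \<theta>_pos by (intro mult_neg_pos) auto
    then show False using wt_le by simp
  qed
  \<comment> \<open>As \<open>b \<ge> 1\<close>, nothing is truncated, and the weight is at most
    \<open>e * \<theta>\<close>.\<close>
  define e where "e = nat (b - 1)"
  have b: "of_int b = real e + 1" using \<open>b \<ge> 1\<close> by (simp add: e_def)
  \<comment> \<open>The floor gives \<open>2 ^ (n - 2) * (e + 1) \<le> sqrt q\<close>; since
    \<open>n \<ge> 3\<close>, the extra \<open>2 ^ (n - 2)\<close> is at least 2.\<close>
  have e: "(2 ^ (n - 2) * e + 2)\<^sup>2 \<le> q"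
  proof -
    have "real e + 1 \<le> 1 / 2 ^ (n - 2) * sqrt (real q)"
      unfolding b[symmetric] b_def by (rule of_int_floor_le)
    then have "2 ^ (n - 2) * (real e + 1) \<le> sqrt (real q)"
      by (simp add: field_simps)
    moreover have "(2::real) ^ 1 \<le> 2 ^ (n - 2)"
      using assms(1) by (intro power_increasing) auto
    ultimately have "real (2 ^ (n - 2) * e + 2) \<le> sqrt (real q)"
      by (simp add: distrib_left)
    then have "(real (2 ^ (n - 2) * e + 2))\<^sup>2 \<le> (sqrt (real q))\<^sup>2"
      by (intro power_mono) auto
    also have "\<dots> = real q" by simp
    finally show ?thesis by (simp only: of_nat_power[symmetric] of_nat_le_iff)
  qed
  define f where "f = (\<lambda>v :: 'f ^ 'm. c (vec.span {v}))"
  have f: "f \<in> hyp_comb"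
    unfolding f_def by (rule hyperplane_code_in_hyp_comb(1)[OF assms(9)])
  have dev: "dev f 0 UNIV = (q - 1) * wt c"
    unfolding f_def by (rule dev_eq_wt)
  have real_qn: "real (q ^ n - 1) = (real q - 1) * \<theta>"
    using q_gt_1 by (simp add: theta of_nat_diff)
  have real_dev: "real (dev f 0 UNIV) = (real q - 1) * real (wt c)"
    using q_gt_1 by (simp add: dev of_nat_diff)
  have "real (dev f 0 UNIV) \<le> real (e * (q ^ n - 1))"
  proof -
    have "real (dev f 0 UNIV) \<le> (real q - 1) * (real e * \<theta>)"
      unfolding real_dev using wt_le q_gt_1 by (intro mult_left_mono) (auto simp: b)
    also have "\<dots> = real (e * (q ^ n - 1))" by (simp only: of_nat_mult real_qn mult_ac)
    finally show ?thesis .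
  qed
  then have wt_bound: "dev f 0 UNIV \<le> e * (q ^ n - 1)" by (simp only: of_nat_le_iff)
  have card_UNIV: "CARD('f ^ 'm) = q ^ (n + 1)"
    using card_subspace[of "UNIV :: ('f ^ 'm) set"] by (simp add: assms(6,7) vec.dim_UNIV card_cart_basis)
  have n: "n - 2 + 3 = n + 1" "n - 2 + 2 = n" using assms(1) by auto
  obtain a where a: "decomp f UNIV a" "card (components UNIV a) \<le> 2 * e"
    using hyperplane_decomposition[OF vec.subspace_UNIV _ f e] card_UNIV wt_bound unfolding n by blast
  define S where "S = components UNIV a"
  have S: "S \<subseteq> pg_hyperplanes" by (auto simp: S_def components_def hyps_UNIV)
  have "c P = (\<Sum>H\<in>S. fun_scale (a H) (char_fun H)) P" for P
  proof (cases "P \<in> pg_points")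
    case True
    then have "card {0 :: 'f ^ 'm} < card P" using pg_point_span(1)[OF True] card_field_gt_1[where 'f='f] by simp
    then obtain v where v: "v \<in> P" "v \<noteq> 0" using card_less_obtain[of "{0}" P] by blast
    then have P: "P = vec.span {v}" using pg_point_span(2)[OF True] by simp
    have "c P = (\<Sum>H\<in>S. if v \<in> H then a H else 0)"
      using components_value[OF a(1) UNIV_I v(2)] by (simp add: P f_def S_def)
    also have "\<dots> = (\<Sum>H\<in>S. a H * char_fun H P)"
    proof (rule sum.cong[OF refl])
      fix H assume "H \<in> S"
      then have "vec.subspace H" using S by (auto simp: pg_hyperplanes_def)
      then have "char_fun H P = (if v \<in> H then 1 else 0 :: 'k)"
        unfolding P by (rule char_fun_span[OF _ v(2)])
      then show "(if v \<in> H then a H else 0) = a H * char_fun H P" by simp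
    qed
    finally show ?thesis by (simp add: sum_fun_apply fun_scale_def)
  next
    case False
    then show ?thesis
      using hyperplane_code_in_hyp_comb(2)[OF assms(9)]
      by (simp add: sum_fun_apply fun_scale_def char_fun_def)
  qed
  then have c_eq: "c = (\<Sum>H\<in>S. fun_scale (a H) (char_fun H))" by blast

  define m where "m = card S"
  define N where "N = q ^ (n - 1)"
  have qN: "q * N = q ^ n" unfolding N_def using assms(1) by (simp add: power_eq_if)
  \<comment> \<open>Here \<open>m \<le> 2 * e \<le> 2 ^ (n - 2) * e\<close>, whose square is at most
    \<open>q\<close>.\<close>
  have "m * (m - 1) \<le> q"
  proof -
    have "(2::nat) ^ 1 \<le> 2 ^ (n - 2)" using assms(1) by (intro power_increasing) auto
    then have "2 * e \<le> 2 ^ (n - 2) * e" by (intro mult_le_mono1) simp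
    then have "m \<le> 2 ^ (n - 2) * e + 2" using a(2) unfolding m_def S_def by linarith
    then have "m * (m - 1) \<le> (2 ^ (n - 2) * e + 2) * (2 ^ (n - 2) * e + 2)"
      by (intro mult_le_mono) auto
    then show ?thesis using e unfolding power2_eq_square by linarith
  qed
  then have bounds: "dev f 0 UNIV \<le> m * (q ^ n - 1)" "m * (q ^ n - 1) < dev f 0 UNIV + (q ^ n - 1)"
    using dev_decomp_bounds[OF vec.subspace_UNIV _ _ a(1), of N m] card_UNIV q_gt_1
    by (simp_all add: qN m_def S_def) (simp_all add: N_def)
  \<comment> \<open>Dividing both bounds by \<open>q - 1\<close> gives
    \<open>(m - 1) * \<theta> < wt c \<le> m * \<theta>\<close>.\<close>
  have "\<lceil>real (wt c) / \<theta>\<rceil> = int m"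
  proof (rule ceiling_unique)
    have q1: "0 < real q - 1" using q_gt_1 by simp
    have "real (m * (q ^ n - 1)) < real (dev f 0 UNIV + (q ^ n - 1))"
      using bounds(2) by (simp only: of_nat_less_iff)
    then have "(real q - 1) * (real m * \<theta>) < (real q - 1) * (real (wt c) + \<theta>)"
      unfolding of_nat_add of_nat_mult real_qn real_dev by (simp add: algebra_simps)
    then have "real m * \<theta> < real (wt c) + \<theta>" using q1 by simp
    then show "of_int (int m) - 1 < real (wt c) / \<theta>" using \<theta>_pos by (simp add: field_simps)
    have "real (dev f 0 UNIV) \<le> real (m * (q ^ n - 1))"
      using bounds(1) by (simp only: of_nat_le_iff)
    then have "(real q - 1) * real (wt c) \<le> (real q - 1) * (real m * \<theta>)"
      unfolding of_nat_mult real_qn real_dev by (simp add: algebra_simps)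
    then have "real (wt c) \<le> real m * \<theta>" using q1 by simp
    then show "real (wt c) / \<theta> \<le> of_int (int m)" using \<theta>_pos by (simp add: field_simps)
  qed
  then have "int (card S) = \<lceil>real (wt c) / theta q (int n - 1)\<rceil>"
    by (simp add: m_def \<theta>_def)
  moreover have "\<forall>H\<in>S. a H \<noteq> 0" by (simp add: S_def components_def)
  ultimately show ?thesis using S c_eq by blast
qed

end
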